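(* Assume the setting described in the context (problem $\min_x F(x)+H(g(x))$ with Assumptions 1 and 2). Assume in addition that $H$ is $M_H$-Lipschitz continuous with $L_gM_H<+\infty$; in particular, if $g$ is affine, then $L_g=0$ and $M_H=+\infty$ (i.e. $H$ not Lipschitz continuous) is allowed, with $L_gM_H:=0$. Let $\rho_0>0$ be given and $\gamma\in(0,1)$ be fixed. Let $\{(x^k,\breve y^k)\}$ be generated by Algorithm 1 (see context) with, for all $k\ge0$, $$\tau_k:=\frac1{k+1},\quad\rho_k:=\frac{\rho_0}{\tau_k},\quad\eta_k:=(1-\gamma)\rho_k,\quad L_k:=L_f+L_gM_H+\frac{M_g^2\rho_k}{\gamma},\quad\beta_{k+1}:=\frac{(1-\tau_k)\tau_{k+1}}{\tau_k}.$$ Then, for all $k\ge1$ and any saddle point $(x^\star,y^\star)$ of $\widetilde{\mathcal L}$: $$\mathcal P(x^k)-\mathcal P^\star\le\frac1{2k}\Big[L_0\|x^0-x^\star\|^2+\frac1{(1-\gamma)\rho_0}\big(\|y^0\|+M_H\big)^2\Big],$$ $$\mathcal D(\breve y^k)-\mathcal D^\star\le\frac1{2k}\Big[L_0\big(\|x^0\|+M_{F^*}\big)^2+\frac1{(1-\gamma)\rho_0}\|y^0-y^\star\|^2\Big],$$ $$\mathcal G_{\mathcal X\times\mathcal Y}(x^k,\breve y^k)\le\frac{\mathcal R^2_{\mathcal X\times\mathcal Y}}{2k},$$ where $\mathcal R^2_{\mathcal X\times\mathcal Y}:=\sup\{L_0\|x-x^0\|^2+\frac1{\eta_0}\|y-y^0\|^2:x\in\mathcal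 X,\ y\in\mathcal Y\}$, and $M_H,M_{F^*}\in[0,+\infty]$ are the Lipschitz constants of $H$ and $F^*$.
   Context: Setting. $\|\cdot\|$ is the Euclidean norm. $f:\mathbb R^p\to\mathbb R$ is convex and differentiable; $h:\mathbb R^p\to\mathbb R\cup\{+\infty\}$ and $H:\mathbb R^n\to\mathbb R\cup\{+\infty\}$ are proper, closed, convex; $F:=f+h$; $g:\mathbb R^p\to\mathbb R^n$ is smooth (possibly nonlinear) with Jacobian $g'(x)\in\mathbb R^{n\times p}$, and $H\circ g$ is convex. $H^*,F^*$ are Fenchel conjugates. $\mathrm{prox}_{\varphi}(x):=\arg\min_y\{\varphi(y)+\frac12\|y-x\|^2\}$. Primal: $\mathcal P(x):=F(x)+H(g(x))$, $\mathcal P^\star:=\min_x\mathcal P(x)$. Dual: $\mathcal D(y):=G(-y)+H^*(y)$ with $G(y):=\max_x\{\langle y,g(x)\rangle-F(x)\}$, $\mathcal D^\star:=\min_y\mathcal D(y)$. Lagrangian: $\widetilde{\mathcal L}(x,y):=F(x)+\langle g(x),y\rangle-H^*(y)$. Assumption 1: there is $(x^\star,y^\star)\in\mathrm{dom}(F)\times\mathrm{dom}(H^* )$ (a saddle point) with $\widetilde{\mathcal L}(x^\star,y)\le\widetilde{\mathcal L}(x^\star,y^\star)\le\widetilde{\mathcal L}(x,y^\star)$ for all $(x,y)\in\mathrm{dom}(F)\times\mathrm{dom}(H^* )$, and $\widetilde{\mathcal L}(x^\star,y^\star)$ is finite. Assumption 2: (a) $\nabla f$ is $L_f$-Lipschitz,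 $L_f\in[0,\infty)$. (b) For every $y\in\mathrm{dom}(H^* )$, $x\mapsto\langle y,g(x)\rangle$ is convex; each $g_i$ is $M_{g_i}$-Lipschitz with $M_{g_i}\in[0,\infty)$; and for every $y\in\mathrm{dom}(H^* )$ the map $x\mapsto g'(x)^\top y$ is $\mathbf L_g(y)$-Lipschitz with $0\le\mathbf L_g(y)\le L_g\|y\|$ for a uniform constant $L_g\in[0,\infty)$. Set $M_g^2:=\sum_{i=1}^nM_{g_i}^2$. Gap function: $\mathcal G_{\mathcal X\times\mathcal Y}(x,y):=\sup\{\widetilde{\mathcal L}(x,\hat y)-\widetilde{\mathcal L}(\hat x,y):\hat x\in\mathcal X,\hat y\in\mathcal Y\}$, where $\mathcal X\subseteq\mathrm{dom}(F)$, $\mathcal Y\subseteq\mathrm{dom}(H^* )$ are nonempty closed sets such that $\mathcal X\times\mathcal Y$ contains a saddle point. Lipschitz constants $M_H$, $M_{F^*}$: the Lipschitz constant over the whole space, equal to $+\infty$ if the function is not real-valued and Lipschitz there (in which case a bound involving it is vacuous). Algorithm 1. Given $(x^0,y^0)\in\mathrm{dom}(F)\times\mathrm{dom}(H^* )$, set $\hat x^0:=x^0$, $\tilde y^0:=y^0$, $\breve y^0:=y^0$, $\Theta_0:=0$. For $k=0,1,2,\dots$, with parameters $\tau_k,L_k,\rho_k,\eta_k,\beta_{k+1}$ (where $L_k>0$): $y^{k+1}:=\mathrm{prox}_{\rho_kH^*}(\tilde y^k+\rho_kg(\hat x^k))$; $x^{k+1}:=\mathrm{prox}_{h/L_k}\big(\hat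 x^k-\frac1{L_k}[\nabla f(\hat x^k)+g'(\hat x^k)^\top y^{k+1}]\big)$; $\Theta_{k+1}:=g(x^{k+1})-g(\hat x^k)+\frac1{\rho_k}(y^{k+1}-\tilde y^k)$; $\tilde y^{k+1}:=\tilde y^k+\eta_k[\Theta_{k+1}-(1-\tau_k)\Theta_k]$; $\hat x^{k+1}:=x^{k+1}+\beta_{k+1}(x^{k+1}-x^k)$; $\breve y^{k+1}:=(1-\tau_k)\breve y^k+\tau_ky^{k+1}$. *)

theory Defs
  imports "HOL-Analysis.Analysis"
begin

section \<open>Extended-real-valued convex functions\<close>

text \<open>
  Functions with values in \<open>\<real> \<union> {+\<infinity>}\<close> are functions into \<^typ>\<open>ereal\<close> which, by
  properness, do not attain \<open>-\<infinity>\<close>.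
\<close>

definition eff_dom :: "('a \<Rightarrow> ereal) \<Rightarrow> 'a set" where
  "eff_dom \<phi> = {x. \<phi> x < \<infinity>}"

definition epi :: "('a \<Rightarrow> ereal) \<Rightarrow> ('a \<times> real) set" where
  "epi \<phi> = {(x, r). \<phi> x \<le> ereal r}"

definition proper_fun :: "('a \<Rightarrow> ereal) \<Rightarrow> bool" where
  "proper_fun \<phi> \<longleftrightarrow> (\<forall>x. \<phi> x \<noteq> -\<infinity>) \<and> eff_dom \<phi> \<noteq> {}"

definition closed_fun :: "('a::topological_space \<Rightarrow> ereal) \<Rightarrow> bool" where
  "closed_fun \<phi> \<longleftrightarrow> closed (epi \<phi>)"

definition convex_fun :: "('a::real_vector \<Rightarrow> ereal) \<Rightarrow> bool" where
  "convex_fun \<phi> \<longleftrightarrow> convex (epi \<phi>)"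

definition fenchel_conj :: "('a::real_inner \<Rightarrow> ereal) \<Rightarrow> 'a \<Rightarrow> ereal" where
  "fenchel_conj \<phi> y = (SUP x. ereal (y \<bullet> x) - \<phi> x)"

definition prox :: "('a::real_normed_vector \<Rightarrow> ereal) \<Rightarrow> 'a \<Rightarrow> 'a" where
  "prox \<phi> x = arg_min (\<lambda>y. \<phi> y + ereal (1 / 2 * (norm (y - x))\<^sup>2)) (\<lambda>_. True)"

definition real_lipschitz :: "real \<Rightarrow> ('a::metric_space \<Rightarrow> ereal) \<Rightarrow> bool" where
  "real_lipschitz C \<phi> \<longleftrightarrow>
     (\<forall>x. \<bar>\<phi> x\<bar> \<noteq> \<infinity>) \<and> C-lipschitz_on UNIV (\<lambda>x. real_of_ereal (\<phi> x))"

text \<open>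
  \<open>M \<in> [0, +\<infinity>]\<close> is a Lipschitz constant of \<open>\<phi>\<close> over the whole space. Any finite constant with
  which \<open>\<phi>\<close> is Lipschitz is admitted, in particular the smallest one; \<open>M = +\<infinity>\<close> means
  precisely that \<open>\<phi>\<close> is not a real-valued Lipschitz function.
\<close>
definition lipschitz_const :: "('a::metric_space \<Rightarrow> ereal) \<Rightarrow> ereal \<Rightarrow> bool" where
  "lipschitz_const \<phi> M \<longleftrightarrow>
     (\<exists>C. M = ereal C \<and> real_lipschitz C \<phi>) \<or> (M = \<infinity> \<and> (\<nexists>C. real_lipschitz C \<phi>))"

section \<open>The primal-dual pair\<close>

definition primal ::
    "('a \<Rightarrow> ereal) \<Rightarrow> ('b \<Rightarrow> ereal) \<Rightarrow> ('a \<Rightarrow> 'b) \<Rightarrow> 'a \<Rightarrow> ereal" where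
  "primal F H g x = F x + H (g x)"

text \<open>
  The optimal values are infima; whenever a saddle point exists they are finite and attained, so
  they are minima.
\<close>
definition primal_opt ::
    "('a \<Rightarrow> ereal) \<Rightarrow> ('b \<Rightarrow> ereal) \<Rightarrow> ('a \<Rightarrow> 'b) \<Rightarrow> ereal" where
  "primal_opt F H g = (INF x. primal F H g x)"

definition dual_G ::
    "('a \<Rightarrow> ereal) \<Rightarrow> ('a \<Rightarrow> 'b::real_inner) \<Rightarrow> 'b \<Rightarrow> ereal" where
  "dual_G F g y = (SUP x. ereal (y \<bullet> g x) - F x)"

definition dual ::
    "('a \<Rightarrow> ereal) \<Rightarrow> ('b::real_inner \<Rightarrow> ereal) \<Rightarrow> ('a \<Rightarrow> 'b) \<Rightarrow> 'b \<Rightarrow> ereal" where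
  "dual F H g y = dual_G F g (- y) + fenchel_conj H y"

definition dual_opt ::
    "('a \<Rightarrow> ereal) \<Rightarrow> ('b::real_inner \<Rightarrow> ereal) \<Rightarrow> ('a \<Rightarrow> 'b) \<Rightarrow> ereal" where
  "dual_opt F H g = (INF y. dual F H g y)"

text \<open>
  The Lagrangian is only meaningful on \<open>dom F \<times> dom H\<^sup>*\<close>, where it is real-valued; elsewhere the
  expression may be \<open>\<infinity> - \<infinity>\<close>, which \<^typ>\<open>ereal\<close> evaluates to \<open>\<infinity>\<close>.
\<close>
definition lagrangian ::
    "('a \<Rightarrow> ereal) \<Rightarrow> ('b::real_inner \<Rightarrow> ereal) \<Rightarrow> ('a \<Rightarrow> 'b) \<Rightarrow> 'a \<Rightarrow> 'b \<Rightarrow> ereal" where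
  "lagrangian F H g x y = F x + ereal (g x \<bullet> y) - fenchel_conj H y"

definition saddle_point ::
    "('a \<Rightarrow> ereal) \<Rightarrow> ('b::real_inner \<Rightarrow> ereal) \<Rightarrow> ('a \<Rightarrow> 'b) \<Rightarrow> 'a \<Rightarrow> 'b \<Rightarrow> bool" where
  "saddle_point F H g xs ys \<longleftrightarrow>
     xs \<in> eff_dom F \<and> ys \<in> eff_dom (fenchel_conj H) \<and>
     (\<forall>x \<in> eff_dom F. \<forall>y \<in> eff_dom (fenchel_conj H).
        lagrangian F H g xs y \<le> lagrangian F H g xs ys \<and>
        lagrangian F H g xs ys \<le> lagrangian F H g x ys) \<and>
     \<bar>lagrangian F H g xs ys\<bar> \<noteq> \<infinity>"

definition gap ::
    "('a \<Rightarrow> ereal) \<Rightarrow> ('b::real_inner \<Rightarrow> ereal) \<Rightarrow> ('a \<Rightarrow> 'b) \<Rightarrow> 'a set \<Rightarrow> 'b set \<Rightarrow> 'a \<Rightarrow> 'b \<Rightarrow> ereal"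
  where
  "gap F H g X Y x y =
     Sup {lagrangian F H g x yh - lagrangian F H g xh y | xh yh. xh \<in> X \<and> yh \<in> Y}"

section \<open>The algorithm\<close>

text \<open>
  \<open>xh\<close>, \<open>yt\<close>, \<open>yb\<close> are the sequences written with a hat, a tilde and a breve, and \<open>nf\<close> is the
  gradient of \<open>f\<close>. All sequences are indexed by the superscript of the iterate.
\<close>
definition algorithm1 ::
    "(real ^ 'p \<Rightarrow> real ^ 'p) \<Rightarrow> (real ^ 'p \<Rightarrow> ereal) \<Rightarrow> (real ^ 'n \<Rightarrow> ereal)
     \<Rightarrow> (real ^ 'p \<Rightarrow> real ^ 'n)
     \<Rightarrow> (nat \<Rightarrow> real) \<Rightarrow> (nat \<Rightarrow> real) \<Rightarrow> (nat \<Rightarrow> real) \<Rightarrow> (nat \<Rightarrow> real) \<Rightarrow> (nat \<Rightarrow> real)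
     \<Rightarrow> (nat \<Rightarrow> real ^ 'p) \<Rightarrow> (nat \<Rightarrow> real ^ 'p)
     \<Rightarrow> (nat \<Rightarrow> real ^ 'n) \<Rightarrow> (nat \<Rightarrow> real ^ 'n) \<Rightarrow> (nat \<Rightarrow> real ^ 'n) \<Rightarrow> (nat \<Rightarrow> real ^ 'n)
     \<Rightarrow> bool" where
  "algorithm1 nf h H g \<tau> L \<rho> \<eta> \<beta> x xh y yt yb \<Theta> \<longleftrightarrow>
     xh 0 = x 0 \<and> yt 0 = y 0 \<and> yb 0 = y 0 \<and> \<Theta> 0 = 0 \<and>
     (\<forall>k.
        y (Suc k) = prox (\<lambda>v. ereal (\<rho> k) * fenchel_conj H v) (yt k + \<rho> k *\<^sub>R g (xh k)) \<and>
        x (Suc k) = prox (\<lambda>u. h u / ereal (L k))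
          (xh k - (1 / L k) *\<^sub>R (nf (xh k) + transpose (jacobian g (at (xh k))) *v y (Suc k))) \<and>
        \<Theta> (Suc k) = g (x (Suc k)) - g (xh k) + (1 / \<rho> k) *\<^sub>R (y (Suc k) - yt k) \<and>
        yt (Suc k) = yt k + \<eta> k *\<^sub>R (\<Theta> (Suc k) - (1 - \<tau> k) *\<^sub>R \<Theta> k) \<and>
        xh (Suc k) = x (Suc k) + \<beta> (Suc k) *\<^sub>R (x (Suc k) - x k) \<and>
        yb (Suc k) = (1 - \<tau> k) *\<^sub>R yb k + \<tau> k *\<^sub>R y (Suc k))"

end

theory Submission
  imports Defs
begin

text \<open>
  Put \<open>V\<^sub>k(v) = F(x\<^sup>k) + \<langle>y\<^sup>k, g(x\<^sup>k)\<rangle> - H\<^sup>*(y\<^sup>k) + \<langle>v - y\<^sup>k, \<Theta>\<^sub>k\<rangle>\<close>. The prox step for \<open>H\<^sup>*\<close> says that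
  \<open>g(x\<^sup>k) - \<Theta>\<^sub>k\<close> is a subgradient of \<open>H\<^sup>*\<close> at \<open>y\<^sup>k\<close>, so \<open>V\<^sub>k(v)\<close> dominates the Lagrangian at
  \<open>(x\<^sup>k, v)\<close>. Comparing the primal prox step with \<open>(1 - \<tau>\<^sub>k) x\<^sup>k + \<tau>\<^sub>k u\<close> shows that
  \<open>k V\<^sub>k(v) + \<rho>\<^sub>0 k\<^sup>2 \<parallel>\<Theta>\<^sub>k\<parallel>\<^sup>2 / 2\<close> plus weighted squared distances to \<open>u\<close> and \<open>v\<close> grows in step \<open>k\<close>
  by at most the Lagrangian at \<open>(u, y\<^sup>k\<^sup>+\<^sup>1)\<close>. Summing, and using concavity of the Lagrangian in its
  dual argument, bounds the duality gap at \<open>(x\<^sup>k, yb\<^sup>k)\<close> against every \<open>(u, v)\<close>.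
  The primal bound follows by choosing for \<open>v\<close> an approximate subgradient of \<open>H\<close> at \<open>g(x\<^sup>k)\<close>, which
  has norm at most \<open>M\<^sub>H\<close>; the dual bound because \<open>dom F\<close> lies in the ball of radius \<open>M\<close> for a Lipschitz
  constant \<open>M\<close> of \<open>F\<^sup>*\<close>.
\<close>

section \<open>Gradient inequalities\<close>

lemma gderiv_along_line:
  fixes s :: "'a::real_inner \<Rightarrow> real"
  assumes "GDERIV s (u + t *\<^sub>R w) :> d"
  shows "((\<lambda>t. s (u + t *\<^sub>R w)) has_real_derivative (d \<bullet> w)) (at t)"
proof -
  have "(s has_derivative (\<lambda>h. h \<bullet> d)) (at (u + t *\<^sub>R w))"
    using assms by (simp add: gderiv_def)
  moreover have "((\<lambda>t. u + t *\<^sub>R w) has_derivative (\<lambda>h. h *\<^sub>R w)) (at t)"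
    by (auto intro!: derivative_eq_intros)
  ultimately have "((\<lambda>t. s (u + t *\<^sub>R w)) has_derivative (\<lambda>h. (h *\<^sub>R w) \<bullet> d)) (at t)"
    by (rule has_derivative_compose[rotated])
  moreover have "(\<lambda>h. (h *\<^sub>R w) \<bullet> d) = (*) (d \<bullet> w)"
    by (simp add: fun_eq_iff inner_commute)
  ultimately show ?thesis by (simp add: has_field_derivative_def)
qed

text \<open>Compare \<open>u\<close> with \<open>u + t *\<^sub>R (v - u)\<close>, bound
  \<open>\<phi>\<close> there by convexity, divide by \<open>t\<close> and let \<open>t\<close> tend
  to 0 from the right. Only differentiability of \<open>s\<close> at \<open>u\<close> enters, so
  \<open>s\<close> may be concave as in the corollary below; the same inequality later yields the
  prox characterization and the affine minorant of \<open>h\<close>.\<close>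

lemma convex_minimizer_gradient_inequality:
  fixes s \<phi> :: "'a::real_inner \<Rightarrow> real"
  assumes conv: "convex_on S \<phi>" and u: "u \<in> S" and v: "v \<in> S"
    and min: "\<And>w. w \<in> S \<Longrightarrow> \<phi> u + s u \<le> \<phi> w + s w"
    and d: "GDERIV s u :> d"
  shows "\<phi> u - d \<bullet> (v - u) \<le> \<phi> v"
proof -
  define p where "p t = s (u + t *\<^sub>R (v - u))" for t
  have "(p has_real_derivative (d \<bullet> (v - u))) (at 0)"
    unfolding p_def by (rule gderiv_along_line) (use d in simp)
  then have "((\<lambda>t. (p t - p 0) / t) \<longlongrightarrow> d \<bullet> (v - u)) (at 0)"
    by (simp add: DERIV_def)
  then have lim: "((\<lambda>t. (p t - p 0) / t) \<longlongrightarrow> d \<bullet> (v - u)) (at_right 0)"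
    by (rule filterlim_mono) (auto simp: at_le)
  have ev: "\<forall>\<^sub>F t in at_right 0. \<phi> u - \<phi> v \<le> (p t - p 0) / t"
  proof -
    have "\<forall>\<^sub>F t in at_right (0::real). t \<in> {0<..<1}"
      by (rule eventually_at_right_real) simp
    then show ?thesis
    proof eventually_elim
      case (elim t)
      have eq: "u + t *\<^sub>R (v - u) = (1 - t) *\<^sub>R u + t *\<^sub>R v"
        by (simp add: algebra_simps)
      have "\<phi> ((1 - t) *\<^sub>R u + t *\<^sub>R v) \<le> (1 - t) * \<phi> u + t * \<phi> v"
        by (rule convex_onD[OF conv]) (use elim u v in auto)
      moreover have "(1 - t) *\<^sub>R u + t *\<^sub>R v \<in> S"
        using convexD[OF convex_on_imp_convex[OF conv] u v, of "1 - t" t] elim by auto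
      ultimately have "\<phi> u + s u \<le> (1 - t) * \<phi> u + t * \<phi> v + p t"
        using min[of "(1 - t) *\<^sub>R u + t *\<^sub>R v"] by (simp add: p_def eq)
      then have "(\<phi> u - \<phi> v) * t \<le> p t - p 0"
        by (simp add: p_def algebra_simps)
      then show ?case using elim by (simp add: pos_le_divide_eq)
    qed
  qed
  have "\<phi> u - \<phi> v \<le> d \<bullet> (v - u)"
    by (rule tendsto_lowerbound[OF lim ev]) simp
  then show ?thesis by simp
qed

corollary convex_gradient_inequality:
  fixes f :: "'a::real_inner \<Rightarrow> real"
  assumes "convex_on UNIV f" "GDERIV f u :> d"
  shows "f u + d \<bullet> (v - u) \<le> f v"
  \<comment> \<open>every point minimizes \<open>f + (- f)\<close>\<close>
  using convex_minimizer_gradient_inequality[OF assms(1), of u v "\<lambda>w. - f w" "- d"]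
    assms(2) by (simp add: GDERIV_minus)

lemma descent_lemma:
  fixes f :: "'a::real_inner \<Rightarrow> real"
  assumes grad: "\<And>u. GDERIV f u :> f' u" and lip: "C-lipschitz_on UNIV f'"
  shows "f v \<le> f u + f' u \<bullet> (v - u) + C / 2 * (norm (v - u))\<^sup>2"
proof -
  define w where "w = v - u"
  \<comment> \<open>Up to a constant, \<open>q\<close> is the gap between the two sides along the
    segment from \<open>u\<close> to \<open>v\<close>. Cauchy-Schwarz and the Lipschitz bound make
    its derivative nonpositive.\<close>
  define q where "q t = f (u + t *\<^sub>R w) - t * (f' u \<bullet> w) - C / 2 * t\<^sup>2 * (norm w)\<^sup>2" for t
  have "q 1 \<le> q 0"
  proof (rule DERIV_nonpos_imp_nonincreasing[of 0 1 q])
    fix t :: real assume t: "0 \<le> t" "t \<le> 1"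
    have "(q has_real_derivative (f' (u + t *\<^sub>R w) \<bullet> w - f' u \<bullet> w - C * t * (norm w)\<^sup>2)) (at t)"
      unfolding q_def
      by (rule derivative_eq_intros gderiv_along_line[OF grad] refl | simp)+
    moreover have "f' (u + t *\<^sub>R w) \<bullet> w - f' u \<bullet> w \<le> C * t * (norm w)\<^sup>2"
    proof -
      have "f' (u + t *\<^sub>R w) \<bullet> w - f' u \<bullet> w \<le> norm (f' (u + t *\<^sub>R w) - f' u) * norm w"
        by (metis inner_diff_left norm_cauchy_schwarz)
      also have "\<dots> \<le> (C * norm (t *\<^sub>R w)) * norm w"
        using lipschitz_onD[OF lip, of "u + t *\<^sub>R w" u]
        by (intro mult_right_mono) (auto simp: dist_norm)
      finally show ?thesis using t by (simp add: power2_eq_square mult_ac)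
    qed
    ultimately show "\<exists>y. (q has_real_derivative y) (at t) \<and> y \<le> 0" by force
  qed simp
  then show ?thesis by (simp add: q_def w_def)
qed

section \<open>Proximal operators\<close>

lemma proper_fun_real:
  assumes "proper_fun \<phi>" "v \<in> eff_dom \<phi>"
  shows "\<phi> v = ereal (real_of_ereal (\<phi> v))"
  using assms by (cases "\<phi> v") (auto simp: eff_dom_def proper_fun_def)

lemma convex_on_real_of_convex_fun:
  assumes "proper_fun \<phi>" "convex_fun \<phi>"
  shows "convex_on (eff_dom \<phi>) (\<lambda>v. real_of_ereal (\<phi> v))"
proof -
  note fin = proper_fun_real[OF assms(1)]
  have key: "\<phi> (a *\<^sub>R u + b *\<^sub>R v) \<le> ereal (a * real_of_ereal (\<phi> u) + b * real_of_ereal (\<phi> v))"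
    if "u \<in> eff_dom \<phi>" "v \<in> eff_dom \<phi>" "0 \<le> a" "0 \<le> b" "a + b = 1" for u v a b
  proof -
    have "(u, real_of_ereal (\<phi> u)) \<in> epi \<phi>" "(v, real_of_ereal (\<phi> v)) \<in> epi \<phi>"
      using fin that by (auto simp: epi_def)
    from convexD[OF _ this that(3-5)] assms(2) show ?thesis
      by (auto simp: convex_fun_def epi_def)
  qed
  have conv: "convex (eff_dom \<phi>)"
    by (rule convexI) (use key in \<open>fastforce simp: eff_dom_def\<close>)
  show ?thesis
    unfolding convex_on_def
  proof (intro conjI conv ballI allI impI)
    fix u v and a b :: real
    assume *: "u \<in> eff_dom \<phi>" "v \<in> eff_dom \<phi>" "0 \<le> a" "0 \<le> b" "a + b = 1"
    then have "a *\<^sub>R u + b *\<^sub>R v \<in> eff_dom \<phi>"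
      using conv by (auto simp: convex_def)
    with fin key[OF *] show "real_of_ereal (\<phi> (a *\<^sub>R u + b *\<^sub>R v))
        \<le> a * real_of_ereal (\<phi> u) + b * real_of_ereal (\<phi> v)"
      by (metis ereal_less_eq(3))
  qed
qed

text \<open>\<open>arg_min\<close> is a choice operator, so \<open>prox\<close> has its defining
  property only once some minimizer exists. The affine minorant makes the objective coercive, and
  coercivity with closedness gives existence.\<close>

lemma prox_minimizes:
  fixes \<phi> :: "'a::euclidean_space \<Rightarrow> ereal"
  assumes closed: "closed_fun \<phi>" and dom: "eff_dom \<phi> \<noteq> {}"
    and minor: "\<And>v. ereal (a \<bullet> v + c) \<le> \<phi> v"
  shows "\<phi> (prox \<phi> x) + ereal (1 / 2 * (norm (prox \<phi> x - x))\<^sup>2)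
       \<le> \<phi> v + ereal (1 / 2 * (norm (v - x))\<^sup>2)"
proof -
  \<comment> \<open>Lower semicontinuity is only available as closedness of the epigraph, so minimize the
    continuous function \<open>q\<close> over a compact piece of the epigraph instead.\<close>
  define q where "q = (\<lambda>z::'a \<times> real. snd z + 1 / 2 * (norm (fst z - x))\<^sup>2)"
  obtain v0 where v0: "\<phi> v0 < \<infinity>" using dom by (auto simp: eff_dom_def)
  define r0 where "r0 = real_of_ereal (\<phi> v0)"
  have r0: "\<phi> v0 = ereal r0"
    using v0 minor[of v0] unfolding r0_def by (cases "\<phi> v0") auto
  define K where "K = epi \<phi> \<inter> {z. q z \<le> q (v0, r0)}"
  have cont: "continuous_on A q" for A
    unfolding q_def by (intro continuous_intros)
  have "closed K"
    unfolding K_def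
    by (intro closed_Int closed_Collect_le cont continuous_intros)
      (use closed in \<open>simp add: closed_fun_def\<close>)
  moreover have "bounded K"
  proof -
    define D where "D = \<bar>q (v0, r0) - c - a \<bullet> x\<bar>"
    \<comment> \<open>On \<open>K\<close> the minorant forces
      \<open>n\<^sup>2 / 2 - norm a * n \<le> D\<close>. Beyond the stated radius,
      \<open>n * (n - 2 * norm a)\<close> is at least \<open>2 * D + 1\<close>, a
      contradiction.\<close>
    have vb: "norm (v - x) \<le> 2 * norm a + 2 * D + 1"
      if "(v, r) \<in> K" for v r
    proof -
      define n where "n = norm (v - x)"
      have "a \<bullet> v + c \<le> r"
        using that minor[of v] by (auto simp: K_def epi_def dest: order_trans)
      moreover have "r + 1 / 2 * n\<^sup>2 \<le> q (v0, r0)"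
        using that by (auto simp: K_def q_def n_def)
      moreover have "- (norm a * n) \<le> a \<bullet> (v - x)"
        using Cauchy_Schwarz_ineq2[of a "v - x"] by (simp add: n_def abs_le_iff)
      ultimately have *: "1 / 2 * n\<^sup>2 - norm a * n \<le> D"
        by (simp add: inner_diff_right D_def)
      show ?thesis
      proof (rule ccontr)
        assume "\<not> ?thesis"
        then have gt: "n > 2 * norm a + 2 * D + 1" by (simp add: n_def)
        moreover have "D \<ge> 0" by (simp add: D_def)
        ultimately have "n \<ge> 1" using norm_ge_zero[of a] by linarith
        with gt \<open>D \<ge> 0\<close> have "1 * (2 * D + 1) \<le> n * (n - 2 * norm a)"
          by (intro mult_mono) auto
        then show False
          using * by (simp add: power2_eq_square algebra_simps)
      qed
    qed
    define B where "B = norm x + (2 * norm a + 2 * D + 1)"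
    have vB: "norm v \<le> B" if "(v, r) \<in> K" for v r
      using vb[OF that] norm_triangle_ineq2[of v x] by (simp add: B_def)
    \<comment> \<open>The height is bounded below by the minorant on the ball just found, and above
      because the quadratic term is nonnegative.\<close>
    have rB: "\<bar>r\<bar> \<le> \<bar>q (v0, r0)\<bar> + norm a * B + \<bar>c\<bar>" if "(v, r) \<in> K" for v r
    proof -
      have "a \<bullet> v + c \<le> r"
        using that minor[of v] by (auto simp: K_def epi_def dest: order_trans)
      moreover have "- (norm a * norm v) \<le> a \<bullet> v"
        using Cauchy_Schwarz_ineq2[of a v] by (simp add: abs_le_iff)
      moreover have "norm a * norm v \<le> norm a * B"
        by (intro mult_left_mono vB[OF that]) simp
      moreover have "r + 1 / 2 * (norm (v - x))\<^sup>2 \<le> q (v0, r0)"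
        using that by (auto simp: K_def q_def)
      moreover have "0 \<le> 1 / 2 * (norm (v - x))\<^sup>2" by simp
      moreover have "0 \<le> norm a * norm v" by simp
      ultimately show ?thesis by linarith
    qed
    show ?thesis
      unfolding bounded_iff
    proof (intro exI ballI)
      fix z assume z: "z \<in> K"
      have "norm z \<le> norm (fst z) + norm (snd z)"
        by (metis norm_Pair_le prod.collapse)
      with vB[of "fst z" "snd z"] rB[of "fst z" "snd z"] z
      show "norm z \<le> B + (\<bar>q (v0, r0)\<bar> + norm a * B + \<bar>c\<bar>)" by simp
    qed
  qed
  ultimately have "compact K" by (simp add: compact_eq_bounded_closed)
  moreover have "(v0, r0) \<in> K" by (simp add: K_def epi_def r0)
  ultimately obtain z where z: "z \<in> K" "\<And>w. w \<in> K \<Longrightarrow> q z \<le> q w"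
    using continuous_attains_inf[OF _ _ cont, of K] by blast
  obtain p r where pr: "z = (p, r)" by (cases z)
  have min: "\<phi> p + ereal (1 / 2 * (norm (p - x))\<^sup>2) \<le> \<phi> v + ereal (1 / 2 * (norm (v - x))\<^sup>2)" for v
  proof (cases "\<phi> v = \<infinity>")
    case False
    then obtain s where s: "\<phi> v = ereal s"
      using minor[of v] by (cases "\<phi> v") auto
    \<comment> \<open>A point of the epigraph outside \<open>K\<close> already has a larger value
      than \<open>(v0, r0)\<close>, so minimality on \<open>K\<close> is minimality
      everywhere.\<close>
    have qz: "q z \<le> q (v, s)"
    proof (cases "(v, s) \<in> K")
      case False
      then have "q (v0, r0) \<le> q (v, s)" by (auto simp: K_def epi_def s)
      with z(1) show ?thesis by (auto simp: K_def)
    qed (use z in blast)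
    have "\<phi> p \<le> ereal r" using z(1) pr by (auto simp: K_def epi_def)
    then have "\<phi> p + ereal (1 / 2 * (norm (p - x))\<^sup>2) \<le> ereal r + ereal (1 / 2 * (norm (p - x))\<^sup>2)"
      by (rule add_right_mono)
    also have "\<dots> = ereal (q z)" by (simp add: q_def pr)
    also have "\<dots> \<le> ereal (q (v, s))" using qz by simp
    also have "\<dots> = \<phi> v + ereal (1 / 2 * (norm (v - x))\<^sup>2)" by (simp add: q_def s)
    finally show ?thesis .
  qed simp
  have "is_arg_min (\<lambda>y. \<phi> y + ereal (1 / 2 * (norm (y - x))\<^sup>2)) (\<lambda>_. True) p"
    unfolding is_arg_min_def using min by (auto simp: not_less)
  then have "is_arg_min (\<lambda>y. \<phi> y + ereal (1 / 2 * (norm (y - x))\<^sup>2)) (\<lambda>_. True) (prox \<phi> x)"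
    unfolding prox_def arg_min_def by (rule someI)
  then show ?thesis by (auto simp: is_arg_min_def not_less)
qed

text \<open>Optimality of the prox point with smooth part
  \<open>1 / 2 * (norm (w - x))\<^sup>2\<close>, whose gradient at \<open>p\<close> is
  \<open>p - x\<close>: the residual \<open>x - p\<close> is a subgradient of \<open>\<phi>\<close>
  at \<open>p\<close>.\<close>

lemma prox_variational:
  fixes \<phi> :: "'a::euclidean_space \<Rightarrow> ereal"
  assumes proper: "proper_fun \<phi>" and closed: "closed_fun \<phi>" and convex: "convex_fun \<phi>"
    and minor: "\<And>v. ereal (a \<bullet> v + c) \<le> \<phi> v"
  shows "prox \<phi> x \<in> eff_dom \<phi>"
    and "v \<in> eff_dom \<phi> \<Longrightarrow> real_of_ereal (\<phi> (prox \<phi> x)) + (x - prox \<phi> x) \<bullet> (v - prox \<phi> x)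
           \<le> real_of_ereal (\<phi> v)"
proof -
  define p where "p = prox \<phi> x"
  have dom: "eff_dom \<phi> \<noteq> {}" using proper by (simp add: proper_fun_def)
  have min: "\<phi> p + ereal (1 / 2 * (norm (p - x))\<^sup>2) \<le> \<phi> v + ereal (1 / 2 * (norm (v - x))\<^sup>2)" for v
    unfolding p_def by (rule prox_minimizes[OF closed dom minor])
  obtain v0 where "\<phi> v0 < \<infinity>" using dom by (auto simp: eff_dom_def)
  with min[of v0] have p: "p \<in> eff_dom \<phi>"
    by (cases "\<phi> p"; cases "\<phi> v0") (auto simp: eff_dom_def)
  then show "prox \<phi> x \<in> eff_dom \<phi>" by (simp add: p_def)
  note fin = proper_fun_real[OF proper]
  define s where "s = (\<lambda>w. 1 / 2 * (norm (w - x))\<^sup>2)"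
  have "GDERIV s p :> p - x"
    unfolding s_def gderiv_def power2_norm_eq_inner
    by (auto intro!: derivative_eq_intros simp: inner_commute algebra_simps)
  moreover have "real_of_ereal (\<phi> p) + s p \<le> real_of_ereal (\<phi> w) + s w" if w: "w \<in> eff_dom \<phi>" for w
  proof -
    obtain a b where "\<phi> p = ereal a" "\<phi> w = ereal b" using fin[OF p] fin[OF w] by blast
    then show ?thesis using min[of w] by (simp add: s_def)
  qed
  ultimately have "real_of_ereal (\<phi> p) - (p - x) \<bullet> (v - p) \<le> real_of_ereal (\<phi> v)"
    if "v \<in> eff_dom \<phi>" for v
    using convex_minimizer_gradient_inequality[OF convex_on_real_of_convex_fun[OF proper convex] p that]
    by blast
  then show "v \<in> eff_dom \<phi> \<Longrightarrow> real_of_ereal (\<phi> (prox \<phi> x)) + (x - prox \<phi> x) \<bullet> (v - prox \<phi> x)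
           \<le> real_of_ereal (\<phi> v)"
    by (auto simp: p_def inner_diff_left algebra_simps)
qed

section \<open>Positive multiples of proper, closed, convex functions\<close>

lemma epi_scale:
  assumes "0 < c"
  shows "epi (\<lambda>v. ereal c * \<phi> v) = (\<lambda>(v, r). (v, r / c)) -` epi \<phi>"
proof -
  have "ereal c * \<phi> v \<le> ereal r \<longleftrightarrow> \<phi> v \<le> ereal (r / c)" for v r
    using assms by (cases "\<phi> v") (auto simp: pos_le_divide_eq mult.commute)
  then show ?thesis by (auto simp: epi_def)
qed

text \<open>The epigraph of the multiple is the preimage of \<open>epi \<phi>\<close> under a
  continuous linear map, so closedness, and below convexity, carry over.\<close>

lemma closed_fun_scale:
  assumes "closed_fun \<phi>" "0 < c"
  shows "closed_fun (\<lambda>v. ereal c * \<phi> v)"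
  unfolding closed_fun_def epi_scale[OF assms(2)]
  by (rule closed_vimage) (use assms in \<open>auto simp: closed_fun_def case_prod_beta intro!: continuous_intros\<close>)

lemma convex_fun_scale:
  assumes "convex_fun \<phi>" "0 < c"
  shows "convex_fun (\<lambda>v. ereal c * \<phi> v)"
  unfolding convex_fun_def epi_scale[OF assms(2)]
  by (rule convex_linear_vimage)
    (use assms in \<open>auto simp: convex_fun_def case_prod_beta add_divide_distrib intro!: linearI\<close>)

lemma eff_dom_scale:
  assumes "0 < c"
  shows "eff_dom (\<lambda>v. ereal c * \<phi> v) = eff_dom \<phi>"
proof -
  have "ereal c * \<phi> v < \<infinity> \<longleftrightarrow> \<phi> v < \<infinity>" for v
    using assms by (cases "\<phi> v") auto
  then show ?thesis by (simp add: eff_dom_def)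
qed

lemma proper_fun_scale:
  assumes "proper_fun \<phi>" "0 < c"
  shows "proper_fun (\<lambda>v. ereal c * \<phi> v)"
proof -
  have "ereal c * \<phi> v \<noteq> -\<infinity>" for v
    using assms by (cases "\<phi> v") (auto simp: proper_fun_def)
  then show ?thesis using assms eff_dom_scale[OF assms(2), of \<phi>] by (simp add: proper_fun_def)
qed

text \<open>The form used for both updates of the algorithm: the factor is \<open>\<rho> k\<close>
  in the dual step and the inverse of \<open>L k\<close> in the primal step.\<close>

lemma prox_scaled_variational:
  fixes \<phi> :: "'a::euclidean_space \<Rightarrow> ereal"
  assumes proper: "proper_fun \<phi>" and closed: "closed_fun \<phi>" and convex: "convex_fun \<phi>"
    and minor: "\<And>v. ereal (a \<bullet> v + b) \<le> \<phi> v" and c: "0 < c"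
    and p: "p = prox (\<lambda>v. ereal c * \<phi> v) x"
  shows "p \<in> eff_dom \<phi>"
    and "v \<in> eff_dom \<phi> \<Longrightarrow> real_of_ereal (\<phi> p) + (1 / c) * ((x - p) \<bullet> (v - p)) \<le> real_of_ereal (\<phi> v)"
proof -
  have minor': "ereal ((c *\<^sub>R a) \<bullet> v + c * b) \<le> ereal c * \<phi> v" for v
    using ereal_mult_left_mono[OF minor[of v], of "ereal c"] c by (simp add: distrib_left)
  note prox = prox_variational[OF proper_fun_scale[OF proper c] closed_fun_scale[OF closed c]
      convex_fun_scale[OF convex c] minor', where x = x, folded p, unfolded eff_dom_scale[OF c]]
  show "p \<in> eff_dom \<phi>" by (rule prox(1))
  assume "v \<in> eff_dom \<phi>"
  from prox(2)[OF this] c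
  show "real_of_ereal (\<phi> p) + (1 / c) * ((x - p) \<bullet> (v - p)) \<le> real_of_ereal (\<phi> v)"
    by (simp add: field_simps)
qed

section \<open>Conjugates and saddle points\<close>

lemma fenchel_young: "ereal (y \<bullet> x) - \<phi> x \<le> fenchel_conj \<phi> y"
  unfolding fenchel_conj_def by (rule SUP_upper) simp

lemma fenchel_conj_affine_minorant:
  assumes "proper_fun \<phi>" "x \<in> eff_dom \<phi>"
  shows "ereal (x \<bullet> y - real_of_ereal (\<phi> x)) \<le> fenchel_conj \<phi> y"
  using fenchel_young[of y x \<phi>] proper_fun_real[OF assms]
  by (metis ereal_minus(1) inner_commute)

text \<open>Each set in the intersection is a closed half-space, the whole space or empty, depending
  on whether \<open>\<phi> x\<close> is finite, \<infinity> or -\<infinity>. Closedness and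
  convexity of the conjugate follow for arbitrary \<open>\<phi>\<close>.\<close>

lemma epi_fenchel_conj: "epi (fenchel_conj \<phi>) = (\<Inter>x. {(y, r). ereal (y \<bullet> x) - \<phi> x \<le> ereal r})"
  by (auto simp: epi_def fenchel_conj_def SUP_le_iff)

lemma closed_fun_fenchel_conj: "closed_fun (fenchel_conj \<phi>)"
  unfolding closed_fun_def epi_fenchel_conj
proof (rule closed_INT, rule ballI)
  fix x
  show "closed {(y, r). ereal (y \<bullet> x) - \<phi> x \<le> ereal r}"
  proof (cases "\<phi> x")
    case (real c)
    have "{(y, r). ereal (y \<bullet> x) - \<phi> x \<le> ereal r} = {z. (x, -1) \<bullet> z \<le> c}"
      by (auto simp: real inner_commute)
    then show ?thesis by (simp add: closed_halfspace_le)
  qed auto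
qed

lemma convex_fun_fenchel_conj: "convex_fun (fenchel_conj \<phi>)"
  unfolding convex_fun_def epi_fenchel_conj
proof (rule convex_INT)
  fix x
  show "convex {(y, r). ereal (y \<bullet> x) - \<phi> x \<le> ereal r}"
  proof (cases "\<phi> x")
    case (real c)
    have "{(y, r). ereal (y \<bullet> x) - \<phi> x \<le> ereal r} = {z. (x, -1) \<bullet> z \<le> c}"
      by (auto simp: real inner_commute)
    then show ?thesis by (simp add: convex_halfspace_le)
  qed auto
qed

lemma proper_fun_fenchel_conj:
  assumes "proper_fun \<phi>" "y \<in> eff_dom (fenchel_conj \<phi>)"
  shows "proper_fun (fenchel_conj \<phi>)"
proof -
  obtain x where x: "x \<in> eff_dom \<phi>" using assms(1) by (auto simp: proper_fun_def)
  have "fenchel_conj \<phi> v \<noteq> -\<infinity>" for v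
    using fenchel_conj_affine_minorant[OF assms(1) x, of v] by auto
  with assms(2) show ?thesis by (auto simp: proper_fun_def)
qed

text \<open>Along the ray through \<open>z\<close> the minorant grows at rate
  \<open>norm z * norm z\<close> and \<open>\<psi>\<close> at rate at most
  \<open>C * norm z\<close>. Points of a domain are slopes of affine minorants of the conjugate and
  conversely, so this one bound controls both \<open>eff_dom F\<close> and the domain of the
  conjugate of \<open>H\<close>.\<close>

lemma affine_minorant_of_lipschitz:
  fixes z :: "'a::real_inner"
  assumes lip: "real_lipschitz C \<psi>" and le: "\<And>y. ereal (z \<bullet> y - c) \<le> \<psi> y"
  shows "norm z \<le> C"
proof (rule ccontr)
  assume "\<not> norm z \<le> C"
  define K where "K = c + real_of_ereal (\<psi> 0)"
  have C: "0 \<le> C" using lip by (auto simp: real_lipschitz_def dest: lipschitz_on_nonneg)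
  with \<open>\<not> norm z \<le> C\<close> have pos: "0 < norm z * (norm z - C)"
    by (intro mult_pos_pos) linarith+
  \<comment> \<open>Far enough along the ray for the excess growth to equal
    \<open>\<bar>K\<bar> + 1\<close>, which exceeds the possible initial offset
    \<open>K\<close>.\<close>
  define t where "t = (\<bar>K\<bar> + 1) / (norm z * (norm z - C))"
  have t: "0 \<le> t" using pos by (simp add: t_def)
  have "ereal (real_of_ereal (\<psi> (t *\<^sub>R z))) = \<psi> (t *\<^sub>R z)"
    using lip by (simp add: real_lipschitz_def ereal_real)
  then have "z \<bullet> (t *\<^sub>R z) - c \<le> real_of_ereal (\<psi> (t *\<^sub>R z))"
    using le[of "t *\<^sub>R z"] by (metis ereal_less_eq(3))
  also have "\<dots> \<le> real_of_ereal (\<psi> 0) + C * norm (t *\<^sub>R z)"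
    using lip lipschitz_onD[of C UNIV "\<lambda>x. real_of_ereal (\<psi> x)" "t *\<^sub>R z" 0]
    by (auto simp: real_lipschitz_def dist_norm)
  finally have "t * (norm z * (norm z - C)) \<le> K"
    using t by (simp add: K_def dot_square_norm power2_eq_square algebra_simps)
  moreover have "t * (norm z * (norm z - C)) = \<bar>K\<bar> + 1"
    unfolding t_def by (rule nonzero_eq_divide_eq[THEN iffD1]) (use pos in auto)
  ultimately show False by linarith
qed

lemma norm_le_of_conj_lipschitz:
  assumes "real_lipschitz C (fenchel_conj \<phi>)" "proper_fun \<phi>" "x \<in> eff_dom \<phi>"
  shows "norm x \<le> C"
  using assms by (blast intro: affine_minorant_of_lipschitz fenchel_conj_affine_minorant)

lemma norm_le_of_lipschitz_conj:
  assumes lip: "real_lipschitz C \<phi>" and y: "y \<in> eff_dom (fenchel_conj \<phi>)"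
  shows "norm y \<le> C"
proof (rule affine_minorant_of_lipschitz[OF lip])
  fix x
  have "\<bar>\<phi> x\<bar> \<noteq> \<infinity>" using lip by (simp add: real_lipschitz_def)
  then show "ereal (y \<bullet> x - real_of_ereal (fenchel_conj \<phi> y)) \<le> \<phi> x"
    using fenchel_young[of y x \<phi>] y
    by (cases "\<phi> x"; cases "fenchel_conj \<phi> y") (auto simp: eff_dom_def)
qed

text \<open>An approximate form of the biconjugate theorem at one point: a hyperplane separating
  \<open>(z, s - \<epsilon>)\<close> from the epigraph is the graph of an affine minorant of
  \<open>H\<close> that almost touches at \<open>z\<close>.\<close>

lemma fenchel_conj_approx:
  fixes H :: "'a::euclidean_space \<Rightarrow> ereal"
  assumes closed: "closed_fun H" and convex: "convex_fun H" and fin: "H z = ereal s"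
    and proper: "proper_fun H" and \<epsilon>: "0 < \<epsilon>"
  obtains y where "y \<in> eff_dom (fenchel_conj H)"
    "s \<le> z \<bullet> y - real_of_ereal (fenchel_conj H y) + \<epsilon>"
proof -
  have "(z, s - \<epsilon>) \<notin> epi H" using \<epsilon> by (simp add: epi_def fin)
  with closed convex have "\<exists>n b. n \<bullet> (z, s - \<epsilon>) < b \<and> (\<forall>w\<in>epi H. n \<bullet> w > b)"
    unfolding closed_fun_def convex_fun_def by (intro separating_hyperplane_closed_point)
  then obtain n b where n: "n \<bullet> (z, s - \<epsilon>) < b" "\<And>w. w \<in> epi H \<Longrightarrow> n \<bullet> w > b"
    by blast
  obtain a \<alpha> where a: "n = (a, \<alpha>)" by (cases n)
  \<comment> \<open>\<open>(z, s)\<close> lies in the epigraph directly above the separated point,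
    so the hyperplane is not vertical and its last coefficient is positive.\<close>
  have "n \<bullet> (z, s) > b" by (rule n) (simp add: epi_def fin)
  with n(1) have "0 < \<alpha> * \<epsilon>" by (simp add: a algebra_simps)
  then have \<alpha>: "0 < \<alpha>" using \<epsilon> by (simp add: zero_less_mult_iff)
  define y where "y = - (1 / \<alpha>) *\<^sub>R a"
  have ya: "a = - (\<alpha> *\<^sub>R y)" using \<alpha> by (simp add: y_def)
  have le: "fenchel_conj H y \<le> ereal (z \<bullet> y - s + \<epsilon>)"
    unfolding fenchel_conj_def
  proof (rule SUP_least)
    fix w
    show "ereal (y \<bullet> w) - H w \<le> ereal (z \<bullet> y - s + \<epsilon>)"
    proof (cases "H w")
      case (real r)
      then have "(w, r) \<in> epi H" by (simp add: epi_def)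
      from n(1) n(2)[OF this] have "\<alpha> * (y \<bullet> w - r) < \<alpha> * (z \<bullet> y - s + \<epsilon>)"
        by (simp add: a ya inner_commute algebra_simps)
      with \<alpha> real show ?thesis by simp
    qed (use proper in \<open>auto simp: proper_fun_def\<close>)
  qed
  then have y: "y \<in> eff_dom (fenchel_conj H)" by (auto simp: eff_dom_def)
  show thesis
  proof (rule that[OF y])
    from proper_fun_real[OF proper_fun_fenchel_conj[OF proper y] y]
    obtain r where "fenchel_conj H y = ereal r" by blast
    with le show "s \<le> z \<bullet> y - real_of_ereal (fenchel_conj H y) + \<epsilon>" by simp
  qed
qed

section \<open>Lagrangian values and weak duality at a saddle point\<close>

lemma lagrangian_real:
  assumes "proper_fun F" "proper_fun H" "x \<in> eff_dom F" "y \<in> eff_dom (fenchel_conj H)"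
  shows "lagrangian F H g x y
    = ereal (real_of_ereal (F x) + g x \<bullet> y - real_of_ereal (fenchel_conj H y))"
  using proper_fun_real[OF assms(1,3)]
    proper_fun_real[OF proper_fun_fenchel_conj[OF assms(2,4)] assms(4)]
  unfolding lagrangian_def by (metis ereal_minus(1) plus_ereal.simps(1))

text \<open>The saddle inequality passes from \<open>xs\<close> to an arbitrary \<open>u\<close>
  with \<open>ys\<close> fixed; Fenchel-Young then bounds the Lagrangian at \<open>(u, ys)\<close>
  by the primal value at \<open>u\<close>.\<close>

lemma saddle_le_primal_opt:
  assumes F: "proper_fun F" and H: "proper_fun H" and saddle: "saddle_point F H g xs ys"
  shows "lagrangian F H g xs ys \<le> primal_opt F H g"
  unfolding primal_opt_def
proof (rule INF_greatest)
  fix u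
  have ys: "ys \<in> eff_dom (fenchel_conj H)" using saddle by (simp add: saddle_point_def)
  show "lagrangian F H g xs ys \<le> primal F H g u"
  proof (cases "u \<in> eff_dom F")
    case True
    then have "lagrangian F H g xs ys \<le> lagrangian F H g u ys"
      using saddle ys by (auto simp: saddle_point_def)
    also have "\<dots> \<le> F u + H (g u)"
    proof -
      obtain a b where "F u = ereal a" "fenchel_conj H ys = ereal b"
        using proper_fun_real[OF F True] proper_fun_real[OF proper_fun_fenchel_conj[OF H ys] ys] by blast
      moreover have "H (g u) \<noteq> -\<infinity>" using H by (simp add: proper_fun_def)
      ultimately show ?thesis
        using fenchel_young[of ys "g u" H]
        by (cases "H (g u)") (auto simp: lagrangian_def inner_commute)
    qed
    finally show ?thesis by (simp add: primal_def)
  next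
    case False
    then show ?thesis by (simp add: eff_dom_def primal_def)
  qed
qed

text \<open>The mirror image: \<open>xs\<close> is one competitor in the supremum defining
  \<open>dual_G F g (- v)\<close>. The sign is reversed because the dual problem is also a
  minimization.\<close>

lemma saddle_le_dual_opt:
  assumes F: "proper_fun F" and H: "proper_fun H" and saddle: "saddle_point F H g xs ys"
  shows "- lagrangian F H g xs ys \<le> dual_opt F H g"
  unfolding dual_opt_def
proof (rule INF_greatest)
  fix v
  have xs: "xs \<in> eff_dom F" using saddle by (simp add: saddle_point_def)
  show "- lagrangian F H g xs ys \<le> dual F H g v"
  proof (cases "v \<in> eff_dom (fenchel_conj H)")
    case True
    then have "- lagrangian F H g xs ys \<le> - lagrangian F H g xs v"
      using saddle xs by (auto simp: saddle_point_def)
    also have "\<dots> \<le> dual_G F g (- v) + fenchel_conj H v"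
    proof -
      obtain a b where ab: "F xs = ereal a" "fenchel_conj H v = ereal b"
        using proper_fun_real[OF F xs] proper_fun_real[OF proper_fun_fenchel_conj[OF H True] True] by blast
      have "ereal ((- v) \<bullet> g xs) - F xs \<le> dual_G F g (- v)"
        unfolding dual_G_def by (rule SUP_upper) simp
      then have "(ereal ((- v) \<bullet> g xs) - F xs) + fenchel_conj H v \<le> dual_G F g (- v) + fenchel_conj H v"
        by (rule add_right_mono)
      then show ?thesis
        by (cases "dual_G F g (- v)") (simp_all add: lagrangian_def ab inner_commute)
    qed
    finally show ?thesis by (simp add: dual_def)
  next
    case False
    then show ?thesis by (simp add: eff_dom_def dual_def)
  qed
qed

section \<open>Energy estimate for the algorithm\<close>

lemma GDERIV_inner_jacobian:
  fixes g :: "real ^ 'p \<Rightarrow> real ^ 'n"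
  assumes "g differentiable (at u)"
  shows "GDERIV (\<lambda>u. v \<bullet> g u) u :> transpose (jacobian g (at u)) *v v"
proof -
  have "(g has_derivative (\<lambda>d. jacobian g (at u) *v d)) (at u)"
    using assms by (simp add: jacobian_works)
  then have "((\<lambda>u. v \<bullet> g u) has_derivative (\<lambda>d. v \<bullet> (jacobian g (at u) *v d))) (at u)"
    by (auto intro!: derivative_eq_intros)
  moreover have "v \<bullet> (jacobian g (at u) *v d) = d \<bullet> (transpose (jacobian g (at u)) *v v)" for d
    by (metis dot_lmul_matrix inner_commute transpose_matrix_vector)
  ultimately show ?thesis by (simp add: gderiv_def)
qed

lemma componentwise_lipschitz_norm:
  fixes g :: "'a::real_normed_vector \<Rightarrow> real ^ 'n"
  assumes "\<And>i. (M i)-lipschitz_on UNIV (\<lambda>u. g u $ i)"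
  shows "(norm (g a - g b))\<^sup>2 \<le> (\<Sum>i\<in>UNIV. (M i)\<^sup>2) * (norm (a - b))\<^sup>2"
proof -
  have "(g a $ i - g b $ i)\<^sup>2 \<le> (M i)\<^sup>2 * (norm (a - b))\<^sup>2" for i
    using power_mono[of "\<bar>g a $ i - g b $ i\<bar>" "M i * norm (a - b)" 2]
      lipschitz_onD[OF assms, of a b i] by (simp add: dist_norm power_mult_distrib)
  then have "(\<Sum>i\<in>UNIV. (g a $ i - g b $ i)\<^sup>2) \<le> (\<Sum>i\<in>UNIV. (M i)\<^sup>2 * (norm (a - b))\<^sup>2)"
    by (rule sum_mono)
  moreover have "(norm (g a - g b))\<^sup>2 = (\<Sum>i\<in>UNIV. (g a $ i - g b $ i)\<^sup>2)"
    unfolding power2_norm_eq_inner inner_vec_def by (simp add: power2_eq_square)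
  ultimately show ?thesis by (simp add: sum_distrib_right)
qed

text \<open>Both differences carry a factor \<open>t\<close>, which reduces the claim to the
  polarization identity for \<open>(a - b) \<bullet> b\<close>.\<close>

lemma primal_three_point:
  fixes x x' xh xt xt' u :: "'a::real_inner"
  assumes xh: "xh = (1 - t) *\<^sub>R x + t *\<^sub>R xt" and x': "x' = (1 - t) *\<^sub>R x + t *\<^sub>R xt'"
  shows "(xh - x') \<bullet> (x' - (1 - t) *\<^sub>R x - t *\<^sub>R u)
    = t\<^sup>2 / 2 * ((norm (xt - u))\<^sup>2 - (norm (xt' - u))\<^sup>2) - (norm (x' - xh))\<^sup>2 / 2"
proof -
  define a b where "a = xt - u" and "b = xt' - u"
  have eq: "xh - x' = t *\<^sub>R (a - b)" "x' - (1 - t) *\<^sub>R x - t *\<^sub>R u = t *\<^sub>R b"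
    "x' - xh = t *\<^sub>R (b - a)"
    by (simp_all add: xh x' a_def b_def algebra_simps)
  show ?thesis
    unfolding eq a_def[symmetric] b_def[symmetric] power2_norm_eq_inner
    by (simp add: inner_diff_left inner_diff_right inner_commute power2_eq_square field_simps)
qed

text \<open>This is where the dual step size comes from. Expanding the update gives the coefficient
  \<open>\<eta> / 2 - \<rho> / 2\<close> of \<open>\<Delta> \<bullet> \<Delta>\<close>, and Young's
  inequality for \<open>e \<bullet> \<Delta>\<close> with weight \<open>\<gamma>\<close> adds
  \<open>\<rho> * \<gamma> / 2\<close>; with \<open>\<eta> = (1 - \<gamma>) * \<rho>\<close> these
  cancel. What remains of \<open>e\<close>, the change of \<open>g\<close> between \<open>xh\<close>
  and the new iterate, is paid for by the primal step.\<close>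

lemma dual_three_point:
  fixes y' yt yt' v \<Theta> \<Theta>' e :: "'a::real_inner"
  assumes \<rho>: "\<rho> > 0" and \<gamma>: "0 < \<gamma>" "\<gamma> < 1"
    and \<Theta>': "\<Theta>' = e + (1 / \<rho>) *\<^sub>R (y' - yt)"
    and yt': "yt' = yt + ((1 - \<gamma>) * \<rho>) *\<^sub>R (\<Theta>' - c *\<^sub>R \<Theta>)"
  shows "(v - y') \<bullet> (\<Theta>' - c *\<^sub>R \<Theta>) + \<rho> / 2 * (norm \<Theta>')\<^sup>2
    \<le> \<rho> * c\<^sup>2 / 2 * (norm \<Theta>)\<^sup>2 + ((norm (yt - v))\<^sup>2 - (norm (yt' - v))\<^sup>2) / (2 * ((1 - \<gamma>) * \<rho>))
      + \<rho> / (2 * \<gamma>) * (norm e)\<^sup>2"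
proof -
  define w where "w = c *\<^sub>R \<Theta>"
  define \<Delta> where "\<Delta> = \<Theta>' - w"
  define \<eta> where "\<eta> = (1 - \<gamma>) * \<rho>"
  have \<eta>: "\<eta> > 0" using \<rho> \<gamma> by (simp add: \<eta>_def)
  have y': "y' = yt + \<rho> *\<^sub>R (\<Theta>' - e)" using \<rho> by (simp add: \<Theta>')
  have "yt' - v = (yt - v) + \<eta> *\<^sub>R \<Delta>" by (simp add: yt' \<Delta>_def w_def \<eta>_def)
  then have "((norm (yt - v))\<^sup>2 - (norm (yt' - v))\<^sup>2) = 2 * \<eta> * ((v - yt) \<bullet> \<Delta> - \<eta> / 2 * (\<Delta> \<bullet> \<Delta>))"
    by (simp only: power2_norm_eq_inner)
      (simp add: inner_diff_left inner_diff_right inner_add_left inner_add_right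
         inner_commute power2_eq_square field_simps)
  then have A: "((norm (yt - v))\<^sup>2 - (norm (yt' - v))\<^sup>2) / (2 * \<eta>)
      = (v - yt) \<bullet> \<Delta> - \<eta> / 2 * (\<Delta> \<bullet> \<Delta>)"
    using \<eta> by (simp only:) simp
  have B: "(v - y') \<bullet> \<Delta> = (v - yt) \<bullet> \<Delta> - \<rho> * (\<Theta>' \<bullet> \<Delta>) + \<rho> * (e \<bullet> \<Delta>)"
    by (simp add: y' inner_diff_left inner_add_left algebra_simps)
  have C: "\<Theta>' \<bullet> \<Delta> = (\<Theta>' \<bullet> \<Theta>' + \<Delta> \<bullet> \<Delta> - w \<bullet> w) / 2"
    by (simp add: \<Delta>_def inner_diff_left inner_diff_right inner_commute)
  have D: "e \<bullet> \<Delta> \<le> \<gamma> / 2 * (\<Delta> \<bullet> \<Delta>) + (e \<bullet> e) / (2 * \<gamma>)"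
  proof -
    have "0 \<le> (\<gamma> *\<^sub>R \<Delta> - e) \<bullet> (\<gamma> *\<^sub>R \<Delta> - e)" by simp
    then have "2 * \<gamma> * (e \<bullet> \<Delta>) \<le> \<gamma>\<^sup>2 * (\<Delta> \<bullet> \<Delta>) + e \<bullet> e"
      by (simp add: inner_diff_left inner_diff_right inner_commute power2_eq_square)
    then have "e \<bullet> \<Delta> \<le> (\<gamma>\<^sup>2 * (\<Delta> \<bullet> \<Delta>) + e \<bullet> e) / (2 * \<gamma>)"
      using \<gamma> by (simp add: pos_le_divide_eq mult.commute)
    then show ?thesis using \<gamma> by (simp add: add_divide_distrib power2_eq_square)
  qed
  have "\<rho> * (e \<bullet> \<Delta>) \<le> \<rho> * (\<gamma> / 2 * (\<Delta> \<bullet> \<Delta>) + (e \<bullet> e) / (2 * \<gamma>))"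
    using D \<rho> by (intro mult_left_mono) auto
  then have "\<rho> * (e \<bullet> \<Delta>) \<le> \<rho> * \<gamma> * (\<Delta> \<bullet> \<Delta>) / 2 + \<rho> / (2 * \<gamma>) * (e \<bullet> e)"
    by (simp add: distrib_left)
  moreover have "w \<bullet> w = c\<^sup>2 * (\<Theta> \<bullet> \<Theta>)" by (simp add: w_def power2_eq_square)
  ultimately have "(v - y') \<bullet> \<Delta> + \<rho> / 2 * (\<Theta>' \<bullet> \<Theta>')
    \<le> \<rho> * c\<^sup>2 / 2 * (\<Theta> \<bullet> \<Theta>) + ((norm (yt - v))\<^sup>2 - (norm (yt' - v))\<^sup>2) / (2 * \<eta>)
      + \<rho> / (2 * \<gamma>) * (e \<bullet> e)"
    unfolding A B C by (simp add: \<eta>_def algebra_simps add_divide_distrib diff_divide_distrib)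
  then show ?thesis by (simp add: \<Delta>_def w_def \<eta>_def power2_norm_eq_inner)
qed

text \<open>The energy argument in real-valued form, with \<open>\<phi>\<close> for \<open>F\<close>
  and \<open>\<psi>\<close> for the conjugate of \<open>H\<close>. The prox steps enter only through
  the inequalities \<open>primal\<close> and \<open>dual\<close>.\<close>

lemma primal_dual_gap_bound:
  fixes x xh :: "nat \<Rightarrow> 'a::real_inner" and y yt yb \<Theta> :: "nat \<Rightarrow> 'b::real_inner"
    and g :: "'a \<Rightarrow> 'b" and \<phi> :: "'a \<Rightarrow> real" and \<psi> :: "'b \<Rightarrow> real"
    and \<tau> \<rho> L :: "nat \<Rightarrow> real"
  assumes \<tau>: "\<And>k. \<tau> k = 1 / (real k + 1)" and \<rho>: "\<And>k. \<rho> k = \<rho>0 * (real k + 1)"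
    and L: "\<And>k. L k = C + M * \<rho> k / \<gamma>"
    and \<rho>0: "0 < \<rho>0" and \<gamma>: "0 < \<gamma>" "\<gamma> < 1" and C: "0 \<le> C" and M: "0 \<le> M"
    and xh0: "xh 0 = x 0" and yt0: "yt 0 = y 0" and yb0: "yb 0 = y 0"
    and \<Theta>_Suc: "\<And>k. \<Theta> (Suc k) = g (x (Suc k)) - g (xh k) + (1 / \<rho> k) *\<^sub>R (y (Suc k) - yt k)"
    and yt_Suc: "\<And>k. yt (Suc k) = yt k + ((1 - \<gamma>) * \<rho> k) *\<^sub>R (\<Theta> (Suc k) - (1 - \<tau> k) *\<^sub>R \<Theta> k)"
    and xh_Suc: "\<And>k. xh (Suc k) = x (Suc k) + ((1 - \<tau> k) * \<tau> (Suc k) / \<tau> k) *\<^sub>R (x (Suc k) - x k)"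
    and yb_Suc: "\<And>k. yb (Suc k) = (1 - \<tau> k) *\<^sub>R yb k + \<tau> k *\<^sub>R y (Suc k)"
    and x_dom: "\<And>k. x k \<in> A" and y_dom: "\<And>k. y k \<in> B"
    and \<psi>_convex: "convex_on B \<psi>"
    and g_lip: "\<And>a b. (norm (g a - g b))\<^sup>2 \<le> M * (norm (a - b))\<^sup>2"
    and primal: "\<And>k u. u \<in> A \<Longrightarrow> \<phi> (x (Suc k)) + y (Suc k) \<bullet> g (x (Suc k))
        \<le> \<phi> u + y (Suc k) \<bullet> g u + L k * ((xh k - x (Suc k)) \<bullet> (x (Suc k) - u))
          + C / 2 * (norm (x (Suc k) - xh k))\<^sup>2"
    and dual: "\<And>k v. v \<in> B \<Longrightarrow> v \<bullet> (g (x (Suc k)) - \<Theta> (Suc k)) - \<psi> v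
        \<le> y (Suc k) \<bullet> (g (x (Suc k)) - \<Theta> (Suc k)) - \<psi> (y (Suc k))"
    and u: "u \<in> A" and v: "v \<in> B" and k: "k \<ge> 1"
  shows "yb k \<in> B"
    and "\<phi> (x k) + v \<bullet> g (x k) - \<psi> v - (\<phi> u + yb k \<bullet> g u - \<psi> (yb k))
    \<le> (L 0 * (norm (x 0 - u))\<^sup>2 + (norm (y 0 - v))\<^sup>2 / ((1 - \<gamma>) * \<rho>0)) / (2 * real k)"
proof -
  \<comment> \<open>Nesterov's auxiliary points: \<open>x (k + 1)\<close> and \<open>xh k\<close> are the same convex combination of \<open>x k\<close>
    with \<open>xt (k + 1)\<close> and \<open>xt k\<close>.\<close>
  define xt where "xt k = (case k of 0 \<Rightarrow> x 0 | Suc j \<Rightarrow> x j + (1 / \<tau> j) *\<^sub>R (x (Suc j) - x j))" for k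
  have \<tau>_pos: "0 < \<tau> k" and \<tau>_le: "\<tau> k \<le> 1" and \<rho>_pos: "0 < \<rho> k" for k
    using \<rho>0 by (auto simp: \<tau> \<rho>)
  have x_Suc: "x (Suc k) = (1 - \<tau> k) *\<^sub>R x k + \<tau> k *\<^sub>R xt (Suc k)" for k
    using \<tau>_pos[of k] by (simp add: xt_def algebra_simps)
  have xh: "xh k = (1 - \<tau> k) *\<^sub>R x k + \<tau> k *\<^sub>R xt k" for k
  proof (cases k)
    case (Suc j)
    have "x j + (1 / \<tau> j) *\<^sub>R (x (Suc j) - x j) = x (Suc j) + (1 / \<tau> j - 1) *\<^sub>R (x (Suc j) - x j)"
      by (simp add: algebra_simps)
    then have "(1 - \<tau> (Suc j)) *\<^sub>R x (Suc j) + \<tau> (Suc j) *\<^sub>R xt (Suc j)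
        = x (Suc j) + (\<tau> (Suc j) * (1 / \<tau> j - 1)) *\<^sub>R (x (Suc j) - x j)"
      by (simp add: xt_def algebra_simps)
    \<comment> \<open>The extrapolation coefficient is chosen exactly so that \<open>xh\<close> is
      this convex combination.\<close>
    moreover have "\<tau> (Suc j) * (1 / \<tau> j - 1) = (1 - \<tau> j) * \<tau> (Suc j) / \<tau> j"
      using \<tau>_pos[of j] by (simp add: field_simps)
    ultimately show ?thesis by (simp add: Suc xh_Suc)
  qed (simp add: xh0 xt_def \<tau>)
  define ell where "ell z = \<phi> u + z \<bullet> g u - \<psi> z" for z
  define V where "V k = \<phi> (x k) + y k \<bullet> g (x k) - \<psi> (y k) + (v - y k) \<bullet> \<Theta> k" for k
  have V_ge: "\<phi> (x (Suc k)) + v \<bullet> g (x (Suc k)) - \<psi> v \<le> V (Suc k)" for k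
    using dual[OF v, of k] by (simp add: V_def inner_diff_left inner_diff_right)
  have step: "V (Suc k) + \<rho> k / 2 * (norm (\<Theta> (Suc k)))\<^sup>2
    \<le> (1 - \<tau> k) * V k + \<tau> k * ell (y (Suc k)) + \<rho> k * (1 - \<tau> k)\<^sup>2 / 2 * (norm (\<Theta> k))\<^sup>2
      + L k * (\<tau> k)\<^sup>2 / 2 * ((norm (xt k - u))\<^sup>2 - (norm (xt (Suc k) - u))\<^sup>2)
      + ((norm (yt k - v))\<^sup>2 - (norm (yt (Suc k) - v))\<^sup>2) / (2 * ((1 - \<gamma>) * \<rho> k))" for k
  proof -
    let ?x = "x (Suc k)" and ?y = "y (Suc k)" and ?t = "\<tau> k"
    define W where "W = C / 2 * (norm (?x - xh k))\<^sup>2"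
    define Q where "Q = \<phi> ?x + ?y \<bullet> g ?x"
    \<comment> \<open>The primal inequality is used at \<open>u\<close> and at \<open>x k\<close>
      with weights \<open>\<tau> k\<close> and \<open>1 - \<tau> k\<close>, instead of at the convex
      combination itself.\<close>
    have 1: "?t * Q \<le> ?t * (\<phi> u + ?y \<bullet> g u + L k * ((xh k - ?x) \<bullet> (?x - u)) + W)"
      using primal[OF u, of k] \<tau>_pos[of k] by (intro mult_left_mono) (auto simp: W_def Q_def)
    have 2: "(1 - ?t) * Q \<le> (1 - ?t) * (\<phi> (x k) + ?y \<bullet> g (x k) + L k * ((xh k - ?x) \<bullet> (?x - x k)) + W)"
      using primal[OF x_dom, of k] \<tau>_le[of k] by (intro mult_left_mono) (auto simp: W_def Q_def)
    \<comment> \<open>The subgradient inequality of the previous dual step exchanges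
      \<open>y (Suc k)\<close> for \<open>y k\<close>. For \<open>k = 0\<close> there is no previous
      step, but the weight \<open>1 - \<tau> 0\<close> vanishes.\<close>
    have 3: "(1 - ?t) * (\<phi> (x k) + ?y \<bullet> g (x k) - \<psi> ?y) \<le> (1 - ?t) * (V k + (?y - v) \<bullet> \<Theta> k)"
    proof (cases k)
      case (Suc j)
      have "?y \<bullet> (g (x k) - \<Theta> k) - \<psi> ?y \<le> y k \<bullet> (g (x k) - \<Theta> k) - \<psi> (y k)"
        using dual[OF y_dom[of "Suc k"], of j] by (simp add: Suc)
      then have "\<phi> (x k) + ?y \<bullet> g (x k) - \<psi> ?y \<le> V k + (?y - v) \<bullet> \<Theta> k"
        by (simp add: V_def inner_diff_left inner_diff_right)
      then show ?thesis using \<tau>_le[of k] by (intro mult_left_mono) auto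
    qed (simp add: \<tau>)
    have split: "?t * ((xh k - ?x) \<bullet> (?x - u)) + (1 - ?t) * ((xh k - ?x) \<bullet> (?x - x k))
        = (xh k - ?x) \<bullet> (?x - (1 - ?t) *\<^sub>R x k - ?t *\<^sub>R u)"
      by (simp add: inner_diff_left inner_diff_right algebra_simps)
    have "Q - \<psi> ?y \<le> (1 - ?t) * (V k + (?y - v) \<bullet> \<Theta> k) + ?t * ell ?y
        + L k * ((xh k - ?x) \<bullet> (?x - (1 - ?t) *\<^sub>R x k - ?t *\<^sub>R u)) + W"
      unfolding split[symmetric] ell_def using 1 2 3 by (simp add: algebra_simps)
    then have "V (Suc k) \<le> (1 - ?t) * V k + ?t * ell ?y + (v - ?y) \<bullet> (\<Theta> (Suc k) - (1 - ?t) *\<^sub>R \<Theta> k)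
        + L k * ((xh k - ?x) \<bullet> (?x - (1 - ?t) *\<^sub>R x k - ?t *\<^sub>R u)) + W"
      by (simp add: V_def Q_def inner_diff_left inner_diff_right algebra_simps)
    also have "(xh k - ?x) \<bullet> (?x - (1 - ?t) *\<^sub>R x k - ?t *\<^sub>R u)
        = ?t\<^sup>2 / 2 * ((norm (xt k - u))\<^sup>2 - (norm (xt (Suc k) - u))\<^sup>2) - (norm (?x - xh k))\<^sup>2 / 2"
      by (rule primal_three_point[OF xh x_Suc])
    also have "L k * (?t\<^sup>2 / 2 * ((norm (xt k - u))\<^sup>2 - (norm (xt (Suc k) - u))\<^sup>2) - (norm (?x - xh k))\<^sup>2 / 2)
        = L k * ?t\<^sup>2 / 2 * ((norm (xt k - u))\<^sup>2 - (norm (xt (Suc k) - u))\<^sup>2)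
          - M * \<rho> k / (2 * \<gamma>) * (norm (?x - xh k))\<^sup>2 - W"
    proof -
      \<comment> \<open>The \<open>C\<close> part of \<open>L k\<close> absorbs the smoothness error
        \<open>W\<close>; the part with \<open>M\<close> is kept to absorb the \<open>e\<close> term
        of \<open>dual_three_point\<close>.\<close>
      have eq: "L k * ((norm (?x - xh k))\<^sup>2 / 2) = M * \<rho> k / (2 * \<gamma>) * (norm (?x - xh k))\<^sup>2 + W"
        by (simp add: W_def L distrib_right add_divide_distrib)
      show ?thesis unfolding right_diff_distrib[of "L k"] eq by simp
    qed
    finally have "V (Suc k) \<le> (1 - ?t) * V k + ?t * ell ?y
        + (v - ?y) \<bullet> (\<Theta> (Suc k) - (1 - ?t) *\<^sub>R \<Theta> k)
        + L k * ?t\<^sup>2 / 2 * ((norm (xt k - u))\<^sup>2 - (norm (xt (Suc k) - u))\<^sup>2)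
        - M * \<rho> k / (2 * \<gamma>) * (norm (?x - xh k))\<^sup>2"
      by simp
    moreover have "\<rho> k / (2 * \<gamma>) * (norm (g ?x - g (xh k)))\<^sup>2
        \<le> \<rho> k / (2 * \<gamma>) * (M * (norm (?x - xh k))\<^sup>2)"
      using g_lip \<rho>_pos[of k] \<gamma> by (intro mult_left_mono) auto
    moreover have "(v - ?y) \<bullet> (\<Theta> (Suc k) - (1 - ?t) *\<^sub>R \<Theta> k) + \<rho> k / 2 * (norm (\<Theta> (Suc k)))\<^sup>2
      \<le> \<rho> k * (1 - ?t)\<^sup>2 / 2 * (norm (\<Theta> k))\<^sup>2
        + ((norm (yt k - v))\<^sup>2 - (norm (yt (Suc k) - v))\<^sup>2) / (2 * ((1 - \<gamma>) * \<rho> k))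
        + \<rho> k / (2 * \<gamma>) * (norm (g ?x - g (xh k)))\<^sup>2"
      by (rule dual_three_point[OF \<rho>_pos \<gamma> \<Theta>_Suc yt_Suc])
    ultimately show ?thesis by (simp add: mult_ac)
  qed
  define \<eta> where "\<eta> = (1 - \<gamma>) * \<rho>0"
  have \<eta>: "\<eta> > 0" using \<gamma> \<rho>0 by (simp add: \<eta>_def)
  \<comment> \<open>The weights result from multiplying \<open>step\<close> by
    \<open>1 / \<tau> k\<close>, that is by \<open>k + 1\<close>.\<close>
  define E where "E k = real k * V k + \<rho>0 * (real k)\<^sup>2 / 2 * (norm (\<Theta> k))\<^sup>2
      + L k * \<tau> k / 2 * (norm (xt k - u))\<^sup>2 + (norm (yt k - v))\<^sup>2 / (2 * \<eta>)" for k
  have E_Suc: "E (Suc k) \<le> E k + ell (y (Suc k))" for k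
  proof -
    let ?n = "real k + 1"
    have 1: "?n * ((1 - \<tau> k) * V k) = real k * V k"
      and 2: "?n * (\<tau> k * ell (y (Suc k))) = ell (y (Suc k))"
      and 3: "?n * V (Suc k) = real (Suc k) * V (Suc k)"
      by (simp_all add: \<tau> field_simps)
    have 4: "?n * (\<rho> k * (1 - \<tau> k)\<^sup>2 / 2 * (norm (\<Theta> k))\<^sup>2) = \<rho>0 * (real k)\<^sup>2 / 2 * (norm (\<Theta> k))\<^sup>2"
    proof -
      have n: "?n * (1 - \<tau> k) = real k" by (simp add: \<tau> field_simps)
      have "?n * (\<rho> k * (1 - \<tau> k)\<^sup>2 / 2 * (norm (\<Theta> k))\<^sup>2)
          = \<rho>0 * (?n * (1 - \<tau> k))\<^sup>2 / 2 * (norm (\<Theta> k))\<^sup>2"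
        by (simp add: \<rho> power_mult_distrib power2_eq_square[of "real k + 1"])
      then show ?thesis by (simp only: n)
    qed
    have 5: "?n * (\<rho> k / 2 * (norm (\<Theta> (Suc k)))\<^sup>2) = \<rho>0 * (real (Suc k))\<^sup>2 / 2 * (norm (\<Theta> (Suc k)))\<^sup>2"
      by (simp add: \<rho> power2_eq_square add.commute)
    have 6: "?n * (L k * (\<tau> k)\<^sup>2 / 2 * ((norm (xt k - u))\<^sup>2 - (norm (xt (Suc k) - u))\<^sup>2))
        = L k * \<tau> k / 2 * ((norm (xt k - u))\<^sup>2 - (norm (xt (Suc k) - u))\<^sup>2)"
    proof -
      have n: "?n * (\<tau> k)\<^sup>2 = \<tau> k" by (simp add: \<tau> power2_eq_square)
      have "?n * (L k * (\<tau> k)\<^sup>2 / 2 * d) = L k * (?n * (\<tau> k)\<^sup>2) / 2 * d" for d by simp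
      then show ?thesis by (simp only: n)
    qed
    have 7: "?n * (((norm (yt k - v))\<^sup>2 - (norm (yt (Suc k) - v))\<^sup>2) / (2 * ((1 - \<gamma>) * \<rho> k)))
       = ((norm (yt k - v))\<^sup>2 - (norm (yt (Suc k) - v))\<^sup>2) / (2 * \<eta>)"
    proof -
      have "2 * ((1 - \<gamma>) * \<rho> k) = ?n * (2 * \<eta>)" by (simp add: \<eta>_def \<rho>)
      moreover have "?n * (d / (?n * (2 * \<eta>))) = d / (2 * \<eta>)" for d by simp
      ultimately show ?thesis by (simp only:)
    qed
    have "?n * (V (Suc k) + \<rho> k / 2 * (norm (\<Theta> (Suc k)))\<^sup>2)
      \<le> ?n * ((1 - \<tau> k) * V k + \<tau> k * ell (y (Suc k)) + \<rho> k * (1 - \<tau> k)\<^sup>2 / 2 * (norm (\<Theta> k))\<^sup>2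
      + L k * (\<tau> k)\<^sup>2 / 2 * ((norm (xt k - u))\<^sup>2 - (norm (xt (Suc k) - u))\<^sup>2)
      + ((norm (yt k - v))\<^sup>2 - (norm (yt (Suc k) - v))\<^sup>2) / (2 * ((1 - \<gamma>) * \<rho> k)))"
      by (intro mult_left_mono step) simp
    then have "real (Suc k) * V (Suc k) + \<rho>0 * (real (Suc k))\<^sup>2 / 2 * (norm (\<Theta> (Suc k)))\<^sup>2
      \<le> real k * V k + ell (y (Suc k)) + \<rho>0 * (real k)\<^sup>2 / 2 * (norm (\<Theta> k))\<^sup>2
      + (L k * \<tau> k / 2 * (norm (xt k - u))\<^sup>2 - L k * \<tau> k / 2 * (norm (xt (Suc k) - u))\<^sup>2)
      + ((norm (yt k - v))\<^sup>2 / (2 * \<eta>) - (norm (yt (Suc k) - v))\<^sup>2 / (2 * \<eta>))"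
      unfolding distrib_left 1 2 3 4 5 6 7 unfolding diff_divide_distrib right_diff_distrib .
    \<comment> \<open>Only the weight of the primal distance varies with \<open>k\<close>; it
      decreases like \<open>C / (k + 1)\<close> plus a constant, which is the direction telescoping
      needs.\<close>
    moreover have "L (Suc k) * \<tau> (Suc k) / 2 * (norm (xt (Suc k) - u))\<^sup>2
        \<le> L k * \<tau> k / 2 * (norm (xt (Suc k) - u))\<^sup>2"
    proof -
      have *: "L i * \<tau> i = C / (real i + 1) + M * \<rho>0 / \<gamma>" for i
        by (simp add: L \<tau> \<rho> distrib_right add_divide_distrib)
      have "L (Suc k) * \<tau> (Suc k) \<le> L k * \<tau> k"
        unfolding * using C by (intro add_right_mono divide_left_mono) auto
      then show ?thesis by (intro mult_right_mono) auto
    qed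
    ultimately show ?thesis
      unfolding E_def by linarith
  qed
  have E_le: "E k \<le> E 0 + (\<Sum>j<k. ell (y (Suc j)))" for k
  proof (induction k)
    case (Suc k)
    with E_Suc[of k] show ?case by simp
  qed simp
  \<comment> \<open>\<open>yb k\<close> is the uniform average of \<open>y 1\<close> to
    \<open>y k\<close>; the initial point drops out because \<open>\<tau> 0 = 1\<close>. The last
    part is Jensen's inequality.\<close>
  have average: "yb k \<in> B \<and> real k *\<^sub>R yb k = (\<Sum>j<k. y (Suc j))
      \<and> real k * \<psi> (yb k) \<le> (\<Sum>j<k. \<psi> (y (Suc j)))" for k
  proof (induction k)
    case (Suc k)
    let ?n = "real k + 1"
    have n: "?n * (1 - \<tau> k) = real k" "?n * \<tau> k = 1" by (simp_all add: \<tau> field_simps)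
    have "yb (Suc k) \<in> B"
      unfolding yb_Suc using convexD[OF convex_on_imp_convex[OF \<psi>_convex], of "yb k" "y (Suc k)"]
        Suc y_dom \<tau>_pos[of k] \<tau>_le[of k] by auto
    moreover have "?n *\<^sub>R yb (Suc k) = real k *\<^sub>R yb k + y (Suc k)"
      unfolding yb_Suc scaleR_add_right scaleR_scaleR n by simp
    moreover have "?n * \<psi> (yb (Suc k)) \<le> real k * \<psi> (yb k) + \<psi> (y (Suc k))"
    proof -
      have "\<psi> (yb (Suc k)) \<le> (1 - \<tau> k) * \<psi> (yb k) + \<tau> k * \<psi> (y (Suc k))"
        unfolding yb_Suc using Suc y_dom \<tau>_pos[of k] \<tau>_le[of k]
        by (intro convex_onD[OF \<psi>_convex]) auto
      then have "?n * \<psi> (yb (Suc k)) \<le> ?n * ((1 - \<tau> k) * \<psi> (yb k) + \<tau> k * \<psi> (y (Suc k)))"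
        by (intro mult_left_mono) auto
      also have "\<dots> = real k * \<psi> (yb k) + \<psi> (y (Suc k))"
        unfolding distrib_left mult.assoc[symmetric] n by simp
      finally show ?thesis .
    qed
    ultimately show ?case using Suc by (simp add: add.commute)
  qed (simp add: yb0 y_dom)
  show "yb k \<in> B" using average by blast
  have "real k * V k \<le> E k"
  proof -
    have "0 \<le> L k * \<tau> k / 2"
      using M C \<gamma> \<rho>_pos[of k] \<tau>_pos[of k] by (simp add: L)
    then show ?thesis using \<rho>0 \<eta> by (simp add: E_def)
  qed
  also have "E k \<le> E 0 + (\<Sum>j<k. ell (y (Suc j)))" by (rule E_le)
  also have "(\<Sum>j<k. ell (y (Suc j))) = real k * \<phi> u + (real k *\<^sub>R yb k) \<bullet> g u - (\<Sum>j<k. \<psi> (y (Suc j)))"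
    using average[of k] by (simp add: ell_def sum.distrib sum_subtractf inner_sum_left)
  also have "\<dots> \<le> real k * \<phi> u + (real k *\<^sub>R yb k) \<bullet> g u - real k * \<psi> (yb k)"
    using average[of k] by simp
  finally have "real k * (V k - (\<phi> u + yb k \<bullet> g u - \<psi> (yb k))) \<le> E 0"
    by (simp add: algebra_simps)
  \<comment> \<open>\<open>V 0\<close> and \<open>\<Theta> 0\<close> carry the factor
    \<open>real 0\<close>, so only the two initial distances survive.\<close>
  also have "E 0 = (L 0 * (norm (x 0 - u))\<^sup>2 + (norm (y 0 - v))\<^sup>2 / ((1 - \<gamma>) * \<rho>0)) / 2"
    (is "_ = ?R / 2")
    by (simp add: E_def xt_def \<tau> yt0 add_divide_distrib \<eta>_def)
  finally have bound: "(V k - (\<phi> u + yb k \<bullet> g u - \<psi> (yb k))) * (2 * real k) \<le> ?R"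
    by (simp add: mult_ac)
  have "\<phi> (x k) + v \<bullet> g (x k) - \<psi> v \<le> V k"
    using V_ge[of "k - 1"] k by simp
  then have "(\<phi> (x k) + v \<bullet> g (x k) - \<psi> v - (\<phi> u + yb k \<bullet> g u - \<psi> (yb k))) * (2 * real k)
     \<le> (V k - (\<phi> u + yb k \<bullet> g u - \<psi> (yb k))) * (2 * real k)"
    by (intro mult_right_mono) auto
  also note bound
  finally show "\<phi> (x k) + v \<bullet> g (x k) - \<psi> v - (\<phi> u + yb k \<bullet> g u - \<psi> (yb k)) \<le> ?R / (2 * real k)"
    using k by (subst pos_le_divide_eq) auto
qed

section \<open>The three convergence rates\<close>

theorem theorem3p5:
  fixes f :: "real ^ 'p \<Rightarrow> real"
    and nf :: "real ^ 'p \<Rightarrow> real ^ 'p"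
    and h F :: "real ^ 'p \<Rightarrow> ereal"
    and H :: "real ^ 'n \<Rightarrow> ereal"
    and g :: "real ^ 'p \<Rightarrow> real ^ 'n"
    and Lf Lg \<rho>0 \<gamma> Mg2 :: real
    and Lgy :: "real ^ 'n \<Rightarrow> real"
    and Mg :: "'n \<Rightarrow> real"
    and MH MFs :: ereal
    and \<tau> \<rho> \<eta> L \<beta> :: "nat \<Rightarrow> real"
    and x xh :: "nat \<Rightarrow> real ^ 'p"
    and y yt yb \<Theta> :: "nat \<Rightarrow> real ^ 'n"
    and X :: "(real ^ 'p) set"
    and Y :: "(real ^ 'n) set"
  \<comment> \<open>setting\<close>
  assumes f_convex: "convex_on UNIV f"
    and f_grad: "\<And>u. GDERIV f u :> nf u"
    and h: "proper_fun h" "closed_fun h" "convex_fun h"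
    and H: "proper_fun H" "closed_fun H" "convex_fun H"
    and F_eq: "\<And>u. F u = ereal (f u) + h u"
    and g_diff: "\<And>u. g differentiable (at u)"
    and g_C1: "continuous_on UNIV (\<lambda>u. jacobian g (at u))"
    and Hg_convex: "convex_fun (H \<circ> g)"
  \<comment> \<open>existence of a saddle point\<close>
    and saddle_exists: "\<exists>xs ys. saddle_point F H g xs ys"
  \<comment> \<open>smoothness of f and g\<close>
    and nf_lipschitz: "Lf-lipschitz_on UNIV nf"
    and yg_convex: "\<And>v. v \<in> eff_dom (fenchel_conj H) \<Longrightarrow> convex_on UNIV (\<lambda>u. v \<bullet> g u)"
    and g_lipschitz: "\<And>i. (Mg i)-lipschitz_on UNIV (\<lambda>u. g u $ i)"
    and Lg_nonneg: "0 \<le> Lg"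
    and jac_lipschitz: "\<And>v. v \<in> eff_dom (fenchel_conj H) \<Longrightarrow>
          (Lgy v)-lipschitz_on UNIV (\<lambda>u. transpose (jacobian g (at u)) *v v) \<and>
          0 \<le> Lgy v \<and> Lgy v \<le> Lg * norm v"
    and Mg2: "Mg2 = (\<Sum>i\<in>UNIV. (Mg i)\<^sup>2)"
  \<comment> \<open>Lipschitz constants of H and of the conjugate of F; note \<open>0 * \<infinity> = 0\<close> in \<open>ereal\<close>\<close>
    and MH: "lipschitz_const H MH"
    and MFs: "lipschitz_const (fenchel_conj F) MFs"
    and LgMH_finite: "ereal Lg * MH < \<infinity>"
  \<comment> \<open>parameters\<close>
    and \<rho>0_pos: "0 < \<rho>0"
    and \<gamma>: "0 < \<gamma>" "\<gamma> < 1"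
    and \<tau>: "\<And>k. \<tau> k = 1 / (real k + 1)"
    and \<rho>: "\<And>k. \<rho> k = \<rho>0 / \<tau> k"
    and \<eta>: "\<And>k. \<eta> k = (1 - \<gamma>) * \<rho> k"
    and L: "\<And>k. L k = Lf + real_of_ereal (ereal Lg * MH) + Mg2 * \<rho> k / \<gamma>"
    and L_pos: "\<And>k. 0 < L k"
    and \<beta>: "\<And>k. \<beta> (Suc k) = (1 - \<tau> k) * \<tau> (Suc k) / \<tau> k"
  \<comment> \<open>iterates\<close>
    and init: "x 0 \<in> eff_dom F" "y 0 \<in> eff_dom (fenchel_conj H)"
    and alg: "algorithm1 nf h H g \<tau> L \<rho> \<eta> \<beta> x xh y yt yb \<Theta>"
  \<comment> \<open>sets in the gap function\<close>
    and X: "X \<noteq> {}" "closed X" "X \<subseteq> eff_dom F"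
    and Y: "Y \<noteq> {}" "closed Y" "Y \<subseteq> eff_dom (fenchel_conj H)"
    and XY_saddle: "\<exists>xs\<in>X. \<exists>ys\<in>Y. saddle_point F H g xs ys"
  shows "\<forall>k\<ge>1. \<forall>xs ys. saddle_point F H g xs ys \<longrightarrow>
      primal F H g (x k) - primal_opt F H g
        \<le> ereal (1 / (2 * real k)) *
           (ereal (L 0 * (norm (x 0 - xs))\<^sup>2)
            + ereal (1 / ((1 - \<gamma>) * \<rho>0)) * (ereal (norm (y 0)) + MH)\<^sup>2)
    \<and> dual F H g (yb k) - dual_opt F H g
        \<le> ereal (1 / (2 * real k)) *
           (ereal (L 0) * (ereal (norm (x 0)) + MFs)\<^sup>2
            + ereal (1 / ((1 - \<gamma>) * \<rho>0) * (norm (y 0 - ys))\<^sup>2))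
    \<and> gap F H g X Y (x k) (yb k)
        \<le> Sup {ereal (L 0 * (norm (u - x 0))\<^sup>2 + 1 / \<eta> 0 * (norm (v - y 0))\<^sup>2) | u v.
                 u \<in> X \<and> v \<in> Y} / ereal (2 * real k)"
proof -
  have Hconj: "proper_fun (fenchel_conj H)" by (rule proper_fun_fenchel_conj[OF H(1) init(2)])
  have dom_F: "eff_dom F = eff_dom h"
    by (auto simp: eff_dom_def F_eq)
  have F: "proper_fun F"
    using h(1) dom_F by (auto simp: proper_fun_def F_eq)
  define Fr where "Fr u = real_of_ereal (F u)" for u
  define hr where "hr u = real_of_ereal (h u)" for u
  define Hs where "Hs v = real_of_ereal (fenchel_conj H v)" for v
  have Fr: "F u = ereal (Fr u)" and Fr_hr: "Fr u = f u + hr u" if "u \<in> eff_dom F" for u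
  proof -
    have "u \<in> eff_dom h" using that by (simp add: dom_F)
    then obtain r where "h u = ereal r" using proper_fun_real[OF h(1)] by blast
    then show "F u = ereal (Fr u)" "Fr u = f u + hr u" by (simp_all add: Fr_def hr_def F_eq)
  qed
  have Hs: "fenchel_conj H v = ereal (Hs v)" if "v \<in> eff_dom (fenchel_conj H)" for v
    using proper_fun_real[OF Hconj that] by (simp add: Hs_def)
  have lagr: "lagrangian F H g u v = ereal (Fr u + v \<bullet> g u - Hs v)"
    if "u \<in> eff_dom F" "v \<in> eff_dom (fenchel_conj H)" for u v
    using lagrangian_real[OF F H(1) that] by (simp add: Fr_def Hs_def inner_commute)
  define JT where "JT u v = transpose (jacobian g (at u)) *v v" for u v
  have JT: "GDERIV (\<lambda>u. v \<bullet> g u) u :> JT u v" for u v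
    unfolding JT_def by (rule GDERIV_inner_jacobian[OF g_diff])

  \<comment> \<open>\<open>xs\<close> minimizes \<open>F + \<langle>ys, g\<rangle>\<close>, whose smooth part then supplies a subgradient of \<open>h\<close>.\<close>
  obtain a b where h_minor: "ereal (a \<bullet> u + b) \<le> h u" for u
  proof -
    obtain xs ys where saddle: "saddle_point F H g xs ys" using saddle_exists by blast
    then have xs: "xs \<in> eff_dom F" and ys: "ys \<in> eff_dom (fenchel_conj H)"
      by (auto simp: saddle_point_def)
    define d where "d = nf xs + JT xs ys"
    have minor: "hr xs - d \<bullet> (u - xs) \<le> hr u" if "u \<in> eff_dom h" for u
    proof (rule convex_minimizer_gradient_inequality[where s = "\<lambda>u. f u + ys \<bullet> g u"])
      show "convex_on (eff_dom h) hr"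
        unfolding hr_def by (rule convex_on_real_of_convex_fun[OF h(1,3)])
      show "GDERIV (\<lambda>u. f u + ys \<bullet> g u) xs :> d"
        unfolding d_def by (rule GDERIV_add[OF f_grad JT])
      show "hr xs + (f xs + ys \<bullet> g xs) \<le> hr w + (f w + ys \<bullet> g w)" if "w \<in> eff_dom h" for w
      proof -
        have w: "w \<in> eff_dom F" using that by (simp add: dom_F)
        then have "lagrangian F H g xs ys \<le> lagrangian F H g w ys"
          using saddle ys by (auto simp: saddle_point_def)
        then show ?thesis using xs ys w by (simp add: lagr Fr_hr)
      qed
    qed (use xs that dom_F in auto)
    have "ereal ((- d) \<bullet> u + (hr xs + d \<bullet> xs)) \<le> h u" for u
    proof (cases "h u")
      case (real r)
      then show ?thesis
        using minor[of u]
        by (simp add: hr_def eff_dom_def inner_diff_right)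
    qed (use h(1) in \<open>auto simp: proper_fun_def\<close>)
    then show thesis by (rule that)
  qed

  \<comment> \<open>The prox steps as variational inequalities\<close>
  from alg have yt0: "yt 0 = y 0" and xh0: "xh 0 = x 0" and yb0: "yb 0 = y 0"
    and y_Suc: "\<And>k. y (Suc k) = prox (\<lambda>v. ereal (\<rho> k) * fenchel_conj H v) (yt k + \<rho> k *\<^sub>R g (xh k))"
    and x_Suc: "\<And>k. x (Suc k) = prox (\<lambda>u. h u / ereal (L k))
          (xh k - (1 / L k) *\<^sub>R (nf (xh k) + JT (xh k) (y (Suc k))))"
    and \<Theta>_Suc: "\<And>k. \<Theta> (Suc k) = g (x (Suc k)) - g (xh k) + (1 / \<rho> k) *\<^sub>R (y (Suc k) - yt k)"
    and yt_Suc: "\<And>k. yt (Suc k) = yt k + \<eta> k *\<^sub>R (\<Theta> (Suc k) - (1 - \<tau> k) *\<^sub>R \<Theta> k)"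
    and xh_Suc: "\<And>k. xh (Suc k) = x (Suc k) + \<beta> (Suc k) *\<^sub>R (x (Suc k) - x k)"
    and yb_Suc: "\<And>k. yb (Suc k) = (1 - \<tau> k) *\<^sub>R yb k + \<tau> k *\<^sub>R y (Suc k)"
    unfolding algorithm1_def JT_def by auto
  have \<rho>': "\<rho> k = \<rho>0 * (real k + 1)" for k by (simp add: \<rho> \<tau>)
  have \<rho>_pos: "0 < \<rho> k" for k using \<rho>0_pos by (simp add: \<rho>')

  \<comment> \<open>Any point of the domain of \<open>H\<close> is the slope of an affine minorant
    of its conjugate, which makes the dual prox well defined.\<close>
  obtain z where z: "z \<in> eff_dom H" using H(1) by (auto simp: proper_fun_def)
  note dual_prox = prox_scaled_variational[OF Hconj closed_fun_fenchel_conj convex_fun_fenchel_conj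
      fenchel_conj_affine_minorant[OF H(1) z, unfolded diff_conv_add_uminus] \<rho>_pos y_Suc, folded Hs_def]
  have y_dom: "y k \<in> eff_dom (fenchel_conj H)" for k
    by (cases k) (use init(2) dual_prox(1) in auto)

  define LM where "LM = real_of_ereal (ereal Lg * MH)"
  \<comment> \<open>A smoothness constant for \<open>v \<bullet> g\<close> uniform over the dual
    domain. If \<open>Lg = 0\<close>, the product is 0 even for infinite \<open>MH\<close>;
    otherwise \<open>MH\<close> is finite and bounds \<open>norm v\<close>.\<close>
  have LM: "Lg * norm v \<le> LM" if "v \<in> eff_dom (fenchel_conj H)" for v
  proof (cases "Lg = 0")
    case False
    with LgMH_finite Lg_nonneg have "MH \<noteq> \<infinity>" by auto
    with MH obtain C where C: "MH = ereal C" "real_lipschitz C H"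
      by (auto simp: lipschitz_const_def)
    then show ?thesis
      using norm_le_of_lipschitz_conj[OF C(2) that] Lg_nonneg by (simp add: LM_def mult_left_mono)
  qed (simp add: LM_def)
  have "0 \<le> LM" using LM[OF init(2)] Lg_nonneg by (meson mult_nonneg_nonneg norm_ge_zero order_trans)
  define C where "C = Lf + LM"
  have C: "0 \<le> C" using \<open>0 \<le> LM\<close> lipschitz_on_nonneg[OF nf_lipschitz] by (simp add: C_def)
  have L': "L k = C + Mg2 * \<rho> k / \<gamma>" for k by (simp add: L C_def LM_def)

  have L_inv: "0 < inverse (L k)" for k using L_pos[of k] by simp
  have x_Suc': "x (Suc k) = prox (\<lambda>u. ereal (inverse (L k)) * h u)
          (xh k - (1 / L k) *\<^sub>R (nf (xh k) + JT (xh k) (y (Suc k))))" for k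
    unfolding x_Suc using L_pos[of k] by (simp add: divide_ereal_def mult.commute)
  note primal_prox = prox_scaled_variational[OF h h_minor L_inv x_Suc', folded hr_def dom_F]
  have x_dom: "x k \<in> eff_dom F" for k
    by (cases k) (use init(1) primal_prox(1) in auto)

  \<comment> \<open>The prox inequality for \<open>h\<close> is combined with two expansions around
    \<open>xh k\<close>: the descent lemma up to the new iterate and convexity down to
    \<open>u\<close>, each for \<open>f\<close> and for \<open>v \<bullet> g\<close>. The latter
    needs \<open>y (Suc k)\<close> in the dual domain.\<close>
  have primal: "Fr (x (Suc k)) + y (Suc k) \<bullet> g (x (Suc k))
      \<le> Fr u + y (Suc k) \<bullet> g u + L k * ((xh k - x (Suc k)) \<bullet> (x (Suc k) - u))
        + C / 2 * (norm (x (Suc k) - xh k))\<^sup>2" if u: "u \<in> eff_dom F" for k u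
  proof -
    define p v N where "p = x (Suc k)" and "v = y (Suc k)" and "N = (norm (p - xh k))\<^sup>2"
    define G where "G = nf (xh k) + JT (xh k) v"
    have v: "v \<in> eff_dom (fenchel_conj H)" by (simp add: v_def y_dom)
    have "hr p + L k * ((xh k - (1 / L k) *\<^sub>R G - p) \<bullet> (u - p)) \<le> hr u"
      using primal_prox(2)[OF u, of k, unfolded divide_inverse inverse_inverse_eq mult_1_left]
      by (simp add: p_def G_def v_def divide_inverse)
    moreover have "L k * ((xh k - (1 / L k) *\<^sub>R G - p) \<bullet> (u - p))
        = - (L k * ((xh k - p) \<bullet> (p - u))) - G \<bullet> (u - p)"
      using L_pos[of k] by (simp add: inner_diff_left inner_diff_right algebra_simps)
    moreover have "f p \<le> f (xh k) + nf (xh k) \<bullet> (p - xh k) + Lf / 2 * N"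
      unfolding N_def by (rule descent_lemma[OF f_grad nf_lipschitz])
    moreover have "f (xh k) + nf (xh k) \<bullet> (u - xh k) \<le> f u"
      by (rule convex_gradient_inequality[OF f_convex f_grad])
    moreover have "v \<bullet> g p \<le> v \<bullet> g (xh k) + JT (xh k) v \<bullet> (p - xh k) + Lgy v / 2 * N"
      unfolding N_def by (rule descent_lemma[OF JT]) (use jac_lipschitz[OF v] in \<open>simp add: JT_def\<close>)
    moreover have "Lgy v / 2 * N \<le> LM / 2 * N"
      using jac_lipschitz[OF v] LM[OF v] by (intro mult_right_mono) (auto simp: N_def)
    moreover have "v \<bullet> g (xh k) + JT (xh k) v \<bullet> (u - xh k) \<le> v \<bullet> g u"
      by (rule convex_gradient_inequality[OF yg_convex[OF v] JT])
    moreover have "G \<bullet> (u - p) = nf (xh k) \<bullet> (u - xh k) - nf (xh k) \<bullet> (p - xh k)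
        + (JT (xh k) v \<bullet> (u - xh k) - JT (xh k) v \<bullet> (p - xh k))"
      by (simp add: G_def inner_add_left inner_diff_right)
    moreover have "C / 2 * N = Lf / 2 * N + LM / 2 * N"
      by (simp add: C_def add_divide_distrib distrib_right)
    ultimately have "f p + hr p + v \<bullet> g p
      \<le> f u + hr u + v \<bullet> g u + L k * ((xh k - p) \<bullet> (p - u)) + C / 2 * N"
      by linarith
    then show ?thesis
      by (simp add: p_def v_def N_def Fr_hr[OF u] Fr_hr[OF x_dom])
  qed

  have dual_step: "v \<bullet> (g (x (Suc k)) - \<Theta> (Suc k)) - Hs v
      \<le> y (Suc k) \<bullet> (g (x (Suc k)) - \<Theta> (Suc k)) - Hs (y (Suc k))"
    if v: "v \<in> eff_dom (fenchel_conj H)" for k v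
  proof -
    have "(1 / \<rho> k) *\<^sub>R (yt k + \<rho> k *\<^sub>R g (xh k) - y (Suc k)) = g (x (Suc k)) - \<Theta> (Suc k)"
      using \<rho>_pos[of k] by (simp add: \<Theta>_Suc algebra_simps)
    then have "(1 / \<rho> k) * ((yt k + \<rho> k *\<^sub>R g (xh k) - y (Suc k)) \<bullet> (v - y (Suc k)))
        = (g (x (Suc k)) - \<Theta> (Suc k)) \<bullet> (v - y (Suc k))"
      by (metis inner_scaleR_left)
    with dual_prox(2)[OF v, of k] show ?thesis
      by (simp add: inner_diff_right inner_commute)
  qed

  \<comment> \<open>Specializing the comparison points\<close>
  define B where "B u v = L 0 * (norm (x 0 - u))\<^sup>2 + (norm (y 0 - v))\<^sup>2 / ((1 - \<gamma>) * \<rho>0)" for u v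
  have Hs_convex: "convex_on (eff_dom (fenchel_conj H)) Hs"
    unfolding Hs_def by (rule convex_on_real_of_convex_fun[OF Hconj convex_fun_fenchel_conj])
  have Mg2_nonneg: "0 \<le> Mg2" by (simp add: Mg2 sum_nonneg)
  have g_lip: "(norm (g a - g b))\<^sup>2 \<le> Mg2 * (norm (a - b))\<^sup>2" for a b
    unfolding Mg2 by (rule componentwise_lipschitz_norm[OF g_lipschitz])
  note gap_bound = primal_dual_gap_bound[OF \<tau> \<rho>' L' \<rho>0_pos \<gamma> C Mg2_nonneg xh0 yt0 yb0 \<Theta>_Suc
      yt_Suc[unfolded \<eta>] xh_Suc[unfolded \<beta>] yb_Suc x_dom y_dom Hs_convex g_lip]
  have bound: "yb k \<in> eff_dom (fenchel_conj H)"
    "Fr (x k) + v \<bullet> g (x k) - Hs v - (Fr u + yb k \<bullet> g u - Hs (yb k)) \<le> B u v / (2 * real k)"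
    if "u \<in> eff_dom F" "v \<in> eff_dom (fenchel_conj H)" "1 \<le> k" for u v k
  proof -
    show "yb k \<in> eff_dom (fenchel_conj H)"
      by (rule gap_bound(1)[OF primal dual_step that])
    show "Fr (x k) + v \<bullet> g (x k) - Hs v - (Fr u + yb k \<bullet> g u - Hs (yb k)) \<le> B u v / (2 * real k)"
      unfolding B_def by (rule gap_bound(2)[OF primal dual_step that])
  qed
  show ?thesis
  proof (intro allI impI)
    fix k :: nat and xs ys
    assume k: "1 \<le> k" and saddle: "saddle_point F H g xs ys"
    then have xs: "xs \<in> eff_dom F" and ys: "ys \<in> eff_dom (fenchel_conj H)"
      by (auto simp: saddle_point_def)
    have yb_dom: "yb k \<in> eff_dom (fenchel_conj H)" by (rule bound(1)[OF xs ys k])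
    define l where "l = Fr xs + ys \<bullet> g xs - Hs ys"
    have l: "lagrangian F H g xs ys = ereal l" by (simp add: l_def lagr xs ys)
    have l_ge: "Fr xs + v \<bullet> g xs - Hs v \<le> l" if "v \<in> eff_dom (fenchel_conj H)" for v
    proof -
      have "lagrangian F H g xs v \<le> lagrangian F H g xs ys"
        using saddle that xs by (simp add: saddle_point_def)
      then show ?thesis unfolding l by (simp add: lagr xs that)
    qed
    have l_le: "l \<le> Fr u + ys \<bullet> g u - Hs ys" if "u \<in> eff_dom F" for u
    proof -
      have "lagrangian F H g xs ys \<le> lagrangian F H g u ys"
        using saddle that ys by (simp add: saddle_point_def)
      then show ?thesis unfolding l by (simp add: lagr ys that)
    qed
    have coeff: "0 < (1 - \<gamma>) * \<rho>0" using \<gamma> \<rho>0_pos by simp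
    have k2: "0 < 1 / (2 * real k)" using k by simp

    have "primal F H g (x k) - primal_opt F H g
        \<le> ereal (1 / (2 * real k)) * (ereal (L 0 * (norm (x 0 - xs))\<^sup>2)
            + ereal (1 / ((1 - \<gamma>) * \<rho>0)) * (ereal (norm (y 0)) + MH)\<^sup>2)" (is "_ \<le> ?R")
    proof (cases "MH = \<infinity>")
      case True
      then have "?R = \<infinity>" using \<gamma> \<rho>0_pos k2 by (simp add: power2_eq_square)
      then show ?thesis by (simp only: ereal_less_eq(1))
    next
      case False
      with MH obtain c where c: "MH = ereal c" "real_lipschitz c H"
        by (auto simp: lipschitz_const_def)
      define r where "r = (L 0 * (norm (x 0 - xs))\<^sup>2 + (norm (y 0) + c)\<^sup>2 / ((1 - \<gamma>) * \<rho>0)) / (2 * real k)"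
      have R: "?R = ereal r" by (simp add: c r_def add_divide_distrib)
      have "\<bar>H (g (x k))\<bar> \<noteq> \<infinity>" using c(2) by (simp add: real_lipschitz_def)
      then obtain s where s: "H (g (x k)) = ereal s" by (cases "H (g (x k))") auto
      \<comment> \<open>Take \<open>u = xs\<close> and a nearly optimal \<open>v\<close> for
        \<open>H\<close> at \<open>g (x k)\<close>; the slack \<epsilon> is then sent to 0. The
        saddle inequality at \<open>yb k\<close> replaces the Lagrangian at
        \<open>(xs, yb k)\<close> by \<open>l\<close>.\<close>
      have "Fr (x k) + s - l \<le> r"
      proof (rule field_le_epsilon)
        fix \<epsilon> :: real assume "0 < \<epsilon>"
        then obtain v where v: "v \<in> eff_dom (fenchel_conj H)" "s \<le> g (x k) \<bullet> v - Hs v + \<epsilon>"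
          using fenchel_conj_approx[OF H(2,3) s H(1)] unfolding Hs_def by blast
        have "norm (y 0 - v) \<le> norm (y 0) + c"
          using norm_triangle_ineq4[of "y 0" v] norm_le_of_lipschitz_conj[OF c(2) v(1)] by linarith
        then have "B xs v / (2 * real k) \<le> r"
          unfolding B_def r_def using coeff
          by (intro divide_right_mono add_left_mono power_mono) auto
        with bound(2)[OF xs v(1) k] v(2) l_ge[OF yb_dom]
        show "Fr (x k) + s - l \<le> r + \<epsilon>" by (simp add: inner_commute)
      qed
      moreover have "primal F H g (x k) = ereal (Fr (x k) + s)"
        by (simp add: primal_def s Fr[OF x_dom])
      moreover have "ereal l \<le> primal_opt F H g"
        using saddle_le_primal_opt[OF F H(1) saddle] by (simp add: l)
      ultimately have "primal F H g (x k) - primal_opt F H g \<le> ereal (Fr (x k) + s) - ereal l"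
        by (intro ereal_minus_mono) auto
      also have "\<dots> \<le> ereal r" using \<open>Fr (x k) + s - l \<le> r\<close> by simp
      finally show ?thesis by (simp only: R)
    qed

    moreover have "dual F H g (yb k) - dual_opt F H g
        \<le> ereal (1 / (2 * real k)) * (ereal (L 0) * (ereal (norm (x 0)) + MFs)\<^sup>2
            + ereal (1 / ((1 - \<gamma>) * \<rho>0) * (norm (y 0 - ys))\<^sup>2))" (is "_ \<le> ?R")
    proof (cases "MFs = \<infinity>")
      case True
      then have "?R = \<infinity>" using L_pos[of 0] k2 by (simp add: power2_eq_square)
      then show ?thesis by (simp only: ereal_less_eq(1))
    next
      case False
      with MFs obtain c where c: "MFs = ereal c" "real_lipschitz c (fenchel_conj F)"
        by (auto simp: lipschitz_const_def)
      define r where "r = (L 0 * (norm (x 0) + c)\<^sup>2 + (norm (y 0 - ys))\<^sup>2 / ((1 - \<gamma>) * \<rho>0)) / (2 * real k)"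
      have R: "?R = ereal r" by (simp add: c r_def add_divide_distrib)
      \<comment> \<open>Here \<open>v = ys\<close> is fixed and \<open>u\<close> ranges over the
        whole domain of \<open>F\<close>, whose points have norm at most \<open>c\<close>; outside
        it the term is -\<infinity>. The saddle inequality at \<open>x k\<close> brings in
        \<open>l\<close>.\<close>
      have "dual_G F g (- yb k) \<le> ereal (r - l - Hs (yb k))"
        unfolding dual_G_def
      proof (rule SUP_least)
        fix u
        show "ereal (- yb k \<bullet> g u) - F u \<le> ereal (r - l - Hs (yb k))"
        proof (cases "u \<in> eff_dom F")
          case True
          have "norm (x 0 - u) \<le> norm (x 0) + c"
            using norm_triangle_ineq4[of "x 0" u] norm_le_of_conj_lipschitz[OF c(2) F True] by linarith
          then have "B u ys / (2 * real k) \<le> r"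
            unfolding B_def r_def using L_pos[of 0]
            by (intro divide_right_mono add_right_mono mult_left_mono power_mono) auto
          with bound(2)[OF True ys k] l_le[OF x_dom, of k] show ?thesis
            by (simp add: Fr[OF True])
        qed (simp add: eff_dom_def)
      qed
      then have "dual F H g (yb k) \<le> ereal (r - l - Hs (yb k)) + ereal (Hs (yb k))"
        unfolding dual_def Hs[OF yb_dom] by (rule add_right_mono)
      moreover have "ereal (- l) \<le> dual_opt F H g"
        using saddle_le_dual_opt[OF F H(1) saddle] by (simp add: l)
      ultimately have "dual F H g (yb k) - dual_opt F H g \<le> ereal (r - l) - ereal (- l)"
        by (intro ereal_minus_mono) auto
      then show ?thesis unfolding R by simp
    qed

    moreover have "gap F H g X Y (x k) (yb k)
        \<le> Sup {ereal (L 0 * (norm (u - x 0))\<^sup>2 + 1 / \<eta> 0 * (norm (v - y 0))\<^sup>2) | u v.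
                 u \<in> X \<and> v \<in> Y} / ereal (2 * real k)"
      unfolding gap_def
    proof (rule Sup_least, clarify)
      fix u v assume uv: "u \<in> X" "v \<in> Y"
      then have u: "u \<in> eff_dom F" and v: "v \<in> eff_dom (fenchel_conj H)"
        using X(3) Y(3) by auto
      have "lagrangian F H g (x k) v - lagrangian F H g u (yb k) \<le> ereal (B u v / (2 * real k))"
        using bound(2)[OF u v k] by (simp add: lagr x_dom u v yb_dom)
      also have "\<dots> = ereal (B u v) / ereal (2 * real k)" using k by simp
      also have "B u v = L 0 * (norm (u - x 0))\<^sup>2 + 1 / \<eta> 0 * (norm (v - y 0))\<^sup>2"
        by (simp add: B_def \<eta> \<rho>' norm_minus_commute)
      also have "ereal \<dots> / ereal (2 * real k)
          \<le> Sup {ereal (L 0 * (norm (u - x 0))\<^sup>2 + 1 / \<eta> 0 * (norm (v - y 0))\<^sup>2) | u v.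
                 u \<in> X \<and> v \<in> Y} / ereal (2 * real k)"
        using k uv by (intro ereal_divide_right_mono Sup_upper) auto
      finally show "lagrangian F H g (x k) v - lagrangian F H g u (yb k)
          \<le> Sup {ereal (L 0 * (norm (u - x 0))\<^sup>2 + 1 / \<eta> 0 * (norm (v - y 0))\<^sup>2) | u v.
                 u \<in> X \<and> v \<in> Y} / ereal (2 * real k)" .
    qed
    ultimately show "primal F H g (x k) - primal_opt F H g
        \<le> ereal (1 / (2 * real k)) *
           (ereal (L 0 * (norm (x 0 - xs))\<^sup>2)
            + ereal (1 / ((1 - \<gamma>) * \<rho>0)) * (ereal (norm (y 0)) + MH)\<^sup>2)
    \<and> dual F H g (yb k) - dual_opt F H g
        \<le> ereal (1 / (2 * real k)) *
           (ereal (L 0) * (ereal (norm (x 0)) + MFs)\<^sup>2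
            + ereal (1 / ((1 - \<gamma>) * \<rho>0) * (norm (y 0 - ys))\<^sup>2))
    \<and> gap F H g X Y (x k) (yb k)
        \<le> Sup {ereal (L 0 * (norm (u - x 0))\<^sup>2 + 1 / \<eta> 0 * (norm (v - y 0))\<^sup>2) | u v.
                 u \<in> X \<and> v \<in> Y} / ereal (2 * real k)"
      by blast
  qed
qed

end
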